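(* Let $K$ be a compact Hausdorff space, let $X$ be an $n$-dimensional subspace of $C(K)$ (real or complex scalars), and let $1\le k\le n$. Then $$\sup\left\{\frac{\pi_2(u)}{\|u\|} \,:\, u:X\to\ell_2^k \text{ linear}\right\}=\sup\left\{\frac{1}{\|P I_{\infty,2}^X\|}\,:\,\mu\in\mathcal{P}(K),\ P^2=P,\ \|P\|=1,\ \operatorname{rank}P\le k,\ \pi_2(P I_{\infty,2}^X)=1\right\},$$ where $P$ ranges over linear operators on the Hilbert space $X_2=I_{\infty,2}(X)\subset L_2(K,\mu)$, and $\frac00$ is interpreted as $0$.
   Context: The scalar field is $\mathbb{R}$ or $\mathbb{C}$. $X$ carries the sup norm of $C(K)$. $\mathcal{P}(K)$ is the set of (regular Borel) probability measures on $K$. For $\mu\in\mathcal{P}(K)$, $I_{\infty,2}:C(K)\to L_2(K,\mu)$ is the canonical identity map, $X_2=I_{\infty,2}(X)$ with the $L_2(K,\mu)$ norm, and $I_{\infty,2}^X:X\to X_2$ is the restriction of $I_{\infty,2}$ to $X$. The conditions $P^2=P$, $\|P\|=1$ mean that $P$ is a nonzero orthogonal projection on $X_2$. For an operator $T:X\to Y$ between Banach spaces, $\pi_2(T)=\sup\big(\sum_{i=1}^m\|TUe_i\|^2\big)^{1/2}$, the supremum over all $m\ge1$ and operators $U:\ell_2^m\to X$ with $\|U\|\le1$, where $(e_i)$ is the unit vector basis of $\ell_2^m$. *)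

theory Defs
  imports "HOL-Analysis.Analysis" "HOL-Probability.Probability"
begin

section \<open>Normed spaces with explicit carriers\<close>

text \<open>
  Carriers and operations are explicit because \<open>\<ell>\<^sub>2\<^sup>m\<close> with variable \<open>m\<close> and the quotient space
  \<open>L\<^sub>2(K, \<mu>)\<close> with variable \<open>\<mu>\<close> are not types.
\<close>

record ('f, 'v) nspace =
  vecs :: "'v set"
  vadd :: "'v \<Rightarrow> 'v \<Rightarrow> 'v"
  vscale :: "'f \<Rightarrow> 'v \<Rightarrow> 'v"
  vnorm :: "'v \<Rightarrow> real"

definition linear_op :: "('f, 'v) nspace \<Rightarrow> ('f, 'w) nspace \<Rightarrow> ('v \<Rightarrow> 'w) \<Rightarrow> bool" where
  "linear_op E F T \<longleftrightarrow>
     (\<forall>x\<in>vecs E. T x \<in> vecs F) \<and>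
     (\<forall>x\<in>vecs E. \<forall>y\<in>vecs E. T (vadd E x y) = vadd F (T x) (T y)) \<and>
     (\<forall>c. \<forall>x\<in>vecs E. T (vscale E c x) = vscale F c (T x))"

text \<open>
  All suprema are taken in \<open>[0, \<infinity>]\<close>, so they need no boundedness side conditions; in \<open>ennreal\<close>
  one has \<open>0 / 0 = 0\<close>.
\<close>

definition opnorm :: "('f, 'v) nspace \<Rightarrow> ('f, 'w) nspace \<Rightarrow> ('v \<Rightarrow> 'w) \<Rightarrow> ennreal" where
  "opnorm E F T = (SUP x\<in>{x \<in> vecs E. vnorm E x \<le> 1}. ennreal (vnorm F (T x)))"

definition subspace_in :: "('f, 'v) nspace \<Rightarrow> 'v set \<Rightarrow> bool" where
  "subspace_in E V \<longleftrightarrow>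
     V \<subseteq> vecs E \<and> V \<noteq> {} \<and>
     (\<forall>x\<in>V. \<forall>y\<in>V. vadd E x y \<in> V) \<and> (\<forall>c. \<forall>x\<in>V. vscale E c x \<in> V)"

definition span_in :: "('f, 'v) nspace \<Rightarrow> 'v set \<Rightarrow> 'v set" where
  "span_in E B = \<Inter>{V. subspace_in E V \<and> B \<subseteq> V}"

definition has_dim :: "('f, 'v) nspace \<Rightarrow> 'v set \<Rightarrow> nat \<Rightarrow> bool" where
  "has_dim E V r \<longleftrightarrow>
     (\<exists>B\<subseteq>vecs E. finite B \<and> card B = r \<and> (\<forall>b\<in>B. b \<notin> span_in E (B - {b})) \<and> span_in E B = V)"

definition rank_le :: "('f, 'v) nspace \<Rightarrow> ('f, 'w) nspace \<Rightarrow> ('v \<Rightarrow> 'w) \<Rightarrow> nat \<Rightarrow> bool" where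
  "rank_le E F T k \<longleftrightarrow> (\<exists>r\<le>k. has_dim F (T ` vecs E) r)"


section \<open>The spaces \<open>\<ell>\<^sub>2\<^sup>m\<close> and the norm \<open>\<pi>\<^sub>2\<close>\<close>

definition ell2 :: "nat \<Rightarrow> ('f::real_normed_field, nat \<Rightarrow> 'f) nspace" where
  "ell2 m =
     \<lparr> vecs = {x. \<forall>i\<ge>m. x i = 0},
       vadd = (\<lambda>x y i. x i + y i),
       vscale = (\<lambda>c x i. c * x i),
       vnorm = (\<lambda>x. L2_set (\<lambda>i. norm (x i)) {..<m}) \<rparr>"

definition unit_vec :: "nat \<Rightarrow> nat \<Rightarrow> 'f::real_normed_field" where
  "unit_vec i = (\<lambda>j. if j = i then 1 else 0)"

definition pi2 ::
  "('f::real_normed_field, 'v) nspace \<Rightarrow> ('f, 'w) nspace \<Rightarrow> ('v \<Rightarrow> 'w) \<Rightarrow> ennreal" where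
  "pi2 E F T =
     (SUP (m, U)\<in>{(m, U). 1 \<le> m \<and> linear_op (ell2 m) E U \<and> opnorm (ell2 m) E U \<le> 1}.
        ennreal (sqrt (\<Sum>i<m. (vnorm F (T (U (unit_vec i))))\<^sup>2)))"


section \<open>The space \<open>C(K)\<close>\<close>

text \<open>
  For compact \<open>K\<close> (the whole type \<^typ>\<open>'a\<close>) the type of bounded continuous functions is \<open>C(K)\<close>
  with the sup norm. The library provides only real scalars on it.
\<close>

definition scaleF ::
  "'f::real_normed_field \<Rightarrow> ('a::topological_space \<Rightarrow>\<^sub>C 'f) \<Rightarrow> ('a \<Rightarrow>\<^sub>C 'f)" where
  "scaleF c f = Bcontfun (\<lambda>x. c * apply_bcontfun f x)"

lemma apply_scaleF [simp]: "apply_bcontfun (scaleF c f) x = c * apply_bcontfun f x"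
proof -
  have "bounded ((\<lambda>y. c * y) ` range (apply_bcontfun f))"
    by (rule bounded_linear_image[OF bounded_apply_bcontfun bounded_linear_mult_right])
  then have "(\<lambda>x. c * apply_bcontfun f x) \<in> bcontfun"
    by (auto simp: bcontfun_def image_image intro!: continuous_intros)
  then show ?thesis
    by (simp add: scaleF_def Bcontfun_inverse)
qed

global_interpretation CK: vector_space
  "scaleF :: 'f::real_normed_field \<Rightarrow> ('a::topological_space \<Rightarrow>\<^sub>C 'f) \<Rightarrow> ('a \<Rightarrow>\<^sub>C 'f)"
  by unfold_locales (auto intro!: bcontfun_eqI simp: algebra_simps)

definition sub_CK :: "('a::topological_space \<Rightarrow>\<^sub>C 'f::real_normed_field) set
    \<Rightarrow> ('f, 'a \<Rightarrow>\<^sub>C 'f) nspace" where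
  "sub_CK X = \<lparr> vecs = X, vadd = (+), vscale = scaleF, vnorm = norm \<rparr>"


section \<open>Probability measures on \<open>K\<close> and \<open>L\<^sub>2(K, \<mu>)\<close>\<close>

definition prob_measures :: "'a::topological_space measure set" where
  "prob_measures = {M. sets M = sets borel \<and> prob_space M \<and>
     (\<forall>A\<in>sets borel.
        emeasure M A = (INF U\<in>{U. open U \<and> A \<subseteq> U}. emeasure M U) \<and>
        emeasure M A = (SUP C\<in>{C. compact C \<and> C \<subseteq> A}. emeasure M C))}"

definition sq_integrable :: "'a measure \<Rightarrow> ('a \<Rightarrow> 'f::real_normed_field) \<Rightarrow> bool" where
  "sq_integrable M f \<longleftrightarrow> f \<in> borel_measurable M \<and> integrable M (\<lambda>x. (norm (f x))\<^sup>2)"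

definition L2_class :: "'a measure \<Rightarrow> ('a \<Rightarrow> 'f::real_normed_field) \<Rightarrow> ('a \<Rightarrow> 'f) set" where
  "L2_class M f = {g. sq_integrable M g \<and> (AE x in M. g x = f x)}"

text \<open>
  Elements of \<open>L\<^sub>2(K, \<mu>)\<close> are almost-everywhere classes; the operations below do not depend on the
  representatives chosen by \<open>L2_rep\<close>.
\<close>

definition L2_rep :: "('a \<Rightarrow> 'f) set \<Rightarrow> 'a \<Rightarrow> 'f" where
  "L2_rep A = (SOME f. f \<in> A)"

definition L2 :: "'a measure \<Rightarrow> ('f::real_normed_field, ('a \<Rightarrow> 'f) set) nspace" where
  "L2 M =
     \<lparr> vecs = L2_class M ` {f. sq_integrable M f},
       vadd = (\<lambda>A B. L2_class M (\<lambda>x. L2_rep A x + L2_rep B x)),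
       vscale = (\<lambda>c A. L2_class M (\<lambda>x. c * L2_rep A x)),
       vnorm = (\<lambda>A. sqrt (\<integral>x. (norm (L2_rep A x))\<^sup>2 \<partial>M)) \<rparr>"

definition I2 :: "'a::topological_space measure \<Rightarrow> ('a \<Rightarrow>\<^sub>C 'f::real_normed_field)
    \<Rightarrow> ('a \<Rightarrow> 'f) set" where
  "I2 M f = L2_class M (apply_bcontfun f)"

definition X2 :: "'a::topological_space measure \<Rightarrow> ('a \<Rightarrow>\<^sub>C 'f::real_normed_field) set
    \<Rightarrow> ('f, ('a \<Rightarrow> 'f) set) nspace" where
  "X2 M X = (L2 M)\<lparr> vecs := I2 M ` X \<rparr>"

end

theory Submission
  imports Defs "HOL-Analysis.Finite_Function_Topology"
begin

text \<open>
  A projection \<open>P\<close> of rank at most \<open>k\<close> yields \<open>u : X \<rightarrow> \<ell>\<^sub>2\<^sup>k\<close>, the coordinates of \<open>P I\<close> in an orthonormal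
  basis of the range of \<open>P\<close>, with the same \<open>\<pi>\<^sub>2\<close> and the same norm. Conversely, normalise \<open>u\<close> to
  \<open>\<pi>\<^sub>2(u) = 1\<close>. By Pietsch's theorem \<open>u = A I\<close> with \<open>\<parallel>A\<parallel> \<le> 1\<close> for some \<open>\<mu>\<close>; let \<open>P\<close> be the orthogonal
  projection onto the eigenspace of \<open>A\<^sup>* A\<close> for the eigenvalue \<open>1\<close>. As \<open>P \<le> A\<^sup>* A\<close>, the norm of \<open>P I\<close> is
  at most that of \<open>u\<close>. If functions \<open>w\<^sub>i\<close> with \<open>\<Sum>|w\<^sub>i|\<^sup>2 \<le> 1\<close> attain \<open>\<pi>\<^sub>2(u)\<close>, then
  \<open>1 = \<Sum>\<parallel>A I w\<^sub>i\<parallel>\<^sup>2 \<le> \<Sum>\<parallel>I w\<^sub>i\<parallel>\<^sup>2 \<le> 1\<close> forces each \<open>I w\<^sub>i\<close> into this eigenspace, whence \<open>\<pi>\<^sub>2(P I) = 1\<close>.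
\<close>

section \<open>Convexity and compactness\<close>

text \<open>The obstacle is that \<open>I2 M\<close> need not be injective on X, so that X_2 is in
  general a proper quotient of X. The geometry is therefore done on X itself, with positive
  semidefinite forms that may have null vectors: functions that agree almost everywhere differ by a
  null vector of the L_2 form, and the form induced by \<open>u\<close> is of the same kind.
  Orthonormal systems then consist of actual functions, and results pass to X_2 because null vectors
  are invisible to the form. The forms take values in a field with an abstract conjugation, so that
  real and complex scalars share one proof.

  The bound on the rank of P has its source in A being isometric on the eigenspace, which therefore
  cannot have a larger dimension than \<open>ell2 k\<close>. The condition that P has norm 1
  excludes P = 0; here it means that the eigenspace must be shown to be nontrivial.\<close>

lemma convex_hull_caratheodory_span:
  fixes S :: "'a::real_vector set"
  assumes "finite B" "S \<subseteq> span B" "y \<in> convex hull S"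
  shows "\<exists>T. finite T \<and> T \<subseteq> S \<and> card T \<le> Suc (card B) \<and> y \<in> convex hull T"
proof -
  let ?P = "\<lambda>T. finite T \<and> T \<subseteq> S \<and> y \<in> convex hull T"
  obtain T\<^sub>0 u\<^sub>0 where T0: "finite T\<^sub>0" "T\<^sub>0 \<subseteq> S" "\<forall>x\<in>T\<^sub>0. 0 \<le> u\<^sub>0 x" "sum u\<^sub>0 T\<^sub>0 = 1" "(\<Sum>v\<in>T\<^sub>0. u\<^sub>0 v *\<^sub>R v) = y"
    using assms(3) unfolding convex_hull_explicit by auto
  then have "?P T\<^sub>0"
    by (auto simp: convex_hull_finite)
  then obtain T where T: "?P T" and least: "\<And>T'. ?P T' \<Longrightarrow> card T \<le> card T'"
    using ex_has_least_nat[of ?P T\<^sub>0 card] by blast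
  \<comment> \<open>A representation with the fewest points has affinely independent support;
    otherwise moving the weights along an affine relation removes one of the points.\<close>
  have "card T \<le> Suc (card B)"
  proof (rule ccontr)
    assume big: "\<not> card T \<le> Suc (card B)"
    then obtain a where a: "a \<in> T"
      by fastforce
    let ?D = "(\<lambda>x. - a + x) ` (T - {a})"
    have "card ?D = card T - 1"
      using T a by (simp add: card_image)
    moreover have "?D \<subseteq> span B"
      using T a assms(2) by (auto intro!: span_diff)
    ultimately have "dependent ?D"
      using independent_span_bound[OF assms(1), of ?D] big by force
    then have "affine_dependent T"
      using affine_dependent_iff_dependent2[OF a] by simp
    then obtain w v where w: "sum w T = 0" "v \<in> T" "w v \<noteq> 0" "(\<Sum>v\<in>T. w v *\<^sub>R v) = 0"
      using affine_dependent_explicit_finite T by blast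
    obtain u where u: "\<forall>x\<in>T. 0 \<le> u x" "sum u T = 1" "(\<Sum>v\<in>T. u v *\<^sub>R v) = y"
      using T by (auto simp: convex_hull_finite)
    obtain p where "p \<in> T" "w p > 0"
    proof -
      have "\<exists>p\<in>T. w p > 0"
      proof (rule ccontr)
        assume "\<not> (\<exists>p\<in>T. w p > 0)"
        then have "\<forall>x\<in>T. - w x = 0"
          using w(1) T sum_nonneg_eq_0_iff[of T "\<lambda>x. - w x"] by (simp add: sum_negf not_less)
        then show False using w by auto
      qed
      then show thesis using that by blast
    qed
    define J where "J = {x\<in>T. w x > 0}"
    have J: "finite J" "J \<noteq> {}"
      using T \<open>p \<in> T\<close> \<open>w p > 0\<close> by (auto simp: J_def)
    then obtain b where b: "b \<in> J" "\<And>x. x \<in> J \<Longrightarrow> u b / w b \<le> u x / w x"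
      using ex_is_arg_min_if_finite[OF J, of "\<lambda>x. u x / w x"] by (auto simp: is_arg_min_linorder)
    \<comment> \<open>The point b has the least ratio u/w among the points with w > 0. This is the
      largest multiple of w that can be subtracted without making a weight negative, and it
      annihilates the weight at b.\<close>
    define c where "c x = u x - (u b / w b) * w x" for x
    have bT: "b \<in> T" "w b > 0"
      using b by (auto simp: J_def)
    have "0 \<le> c x" if "x \<in> T" for x
    proof (cases "w x > 0")
      case True
      then have "(u b / w b) * w x \<le> u x"
        using b(2)[of x] that by (simp add: J_def pos_le_divide_eq)
      then show ?thesis by (simp add: c_def)
    next
      case False
      then have "(u b / w b) * w x \<le> 0"
        using bT u(1) by (intro mult_nonneg_nonpos) auto
      then show ?thesis
        using u(1) that by (force simp: c_def)
    qed
    moreover have "c b = 0"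
      using bT by (simp add: c_def)
    moreover have "sum c T = sum u T - (u b / w b) * sum w T"
      by (simp add: c_def sum_subtractf sum_distrib_left del: times_divide_eq_left)
    then have "sum c T = 1"
      using u w by simp
    moreover have "(\<Sum>v\<in>T. c v *\<^sub>R v) = (\<Sum>v\<in>T. u v *\<^sub>R v) - (u b / w b) *\<^sub>R (\<Sum>v\<in>T. w v *\<^sub>R v)"
      by (simp add: c_def sum_subtractf scaleR_left_diff_distrib scaleR_sum_right)
    then have "(\<Sum>v\<in>T. c v *\<^sub>R v) = y"
      using u w by simp
    ultimately have "y \<in> convex hull (T - {b})"
      using T bT by (auto simp: convex_hull_finite sum.remove[of T b] intro!: exI[of _ c])
    then have "card T \<le> card (T - {b})"
      using T by (intro least) auto
    then show False
      using T bT by (metis card_Diff1_less linorder_not_less)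
  qed
  then show ?thesis
    using T by blast
qed

text \<open>By Caratheodory a bounded number of points suffices. Repeatedly joining a set with S
  preserves compactness, and after \<open>card B\<close> rounds all combinations of
  \<open>Suc (card B)\<close> points have been reached.\<close>

lemma compact_convex_hull_span:
  fixes S :: "'a::real_normed_vector set"
  assumes "compact S" "finite B" "S \<subseteq> span B"
  shows "compact (convex hull S)"
proof -
  define step where "step C = {(1 - u) *\<^sub>R x + u *\<^sub>R y |x y u. 0 \<le> u \<and> u \<le> 1 \<and> x \<in> S \<and> y \<in> C}" for C
  define C where "C n = (step ^^ n) S" for n
  have C_Suc: "C (Suc n) = step (C n)" for n
    by (simp add: C_def)
  have compact: "compact (C n)" for n
    by (induction n)
      (use assms(1) in \<open>auto simp: C_Suc step_def intro!: compact_convex_combinations, simp add: C_def\<close>)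
  have upper: "C n \<subseteq> convex hull S" for n
  proof (induction n)
    case 0
    show ?case by (simp add: C_def hull_subset)
  next
    case (Suc n)
    then show ?case
      by (auto simp: C_Suc step_def intro!: convexD_alt[OF convex_convex_hull] intro: hull_inc)
  qed
  have S_sub: "S \<subseteq> C n" for n
  proof (induction n)
    case (Suc n)
    show ?case
    proof
      fix x assume "x \<in> S"
      then show "x \<in> C (Suc n)"
        using Suc unfolding C_Suc step_def
        by (intro CollectI exI[of _ x] exI[of _ 0]) auto
    qed
  qed (simp add: C_def)
  have lower: "convex hull T \<subseteq> C n" if "finite T" "T \<subseteq> S" "card T \<le> Suc n" for T n
    using that
  proof (induction T arbitrary: n rule: finite_induct)
    case (insert a T)
    show ?case
    proof (cases "T = {}")
      case True
      then show ?thesis using S_sub insert.prems by auto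
    next
      case False
      then obtain m where m: "n = Suc m"
        using insert by (cases n) auto
      have "convex hull T \<subseteq> C m"
        using insert m by auto
      then show ?thesis
        using insert.prems unfolding m C_Suc step_def convex_hull_insert[OF False]
      proof clarsimp
        fix u v b assume u: "0 \<le> u" "0 \<le> v" "u + v = (1::real)" and b: "b \<in> convex hull T"
        then have "u = 1 - v" "v \<le> 1" "b \<in> C m"
          using \<open>convex hull T \<subseteq> C m\<close> by auto
        then show "\<exists>x y w. u *\<^sub>R a + v *\<^sub>R b = (1 - w) *\<^sub>R x + w *\<^sub>R y \<and> 0 \<le> w \<and> w \<le> 1 \<and> x \<in> S \<and> y \<in> C m"
          using insert.prems u by blast
      qed
    qed
  qed simp
  have "convex hull S = C (card B)"
  proof
    show "convex hull S \<subseteq> C (card B)"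
    proof
      fix y assume "y \<in> convex hull S"
      then obtain T where "finite T" "T \<subseteq> S" "card T \<le> Suc (card B)" "y \<in> convex hull T"
        using convex_hull_caratheodory_span[OF assms(2,3)] by blast
      then show "y \<in> C (card B)"
        using lower by blast
    qed
  qed (rule upper)
  then show ?thesis
    using compact by simp
qed

text \<open>
  A minimiser of \<^term>\<open>\<lambda>p. \<Sum>i\<in>I. (max 0 (- f i p))\<^sup>2\<close> on \<open>S\<close> satisfies all inequalities: otherwise its
  negative parts are the coefficients of a combination that contradicts the hypothesis, because the
  minimum could be lowered by moving towards the point that the hypothesis provides.
\<close>

lemma finite_affine_inequalities_feasible:
  fixes S :: "'a::real_normed_vector set" and f :: "'i \<Rightarrow> 'a \<Rightarrow> real"
  assumes "compact S" "convex S" "S \<noteq> {}" "finite I"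
    and cont: "\<And>i. i \<in> I \<Longrightarrow> continuous_on S (f i)"
    and aff: "\<And>i p p' s. i \<in> I \<Longrightarrow> f i ((1 - s) *\<^sub>R p + s *\<^sub>R p') = (1 - s) * f i p + s * f i p'"
    and comb: "\<And>d. (\<And>i. i \<in> I \<Longrightarrow> 0 \<le> d i) \<Longrightarrow> \<exists>p\<in>S. 0 \<le> (\<Sum>i\<in>I. d i * f i p)"
  shows "\<exists>p\<in>S. \<forall>i\<in>I. 0 \<le> f i p"
proof -
  define g where "g p = (\<Sum>i\<in>I. (max 0 (- f i p))\<^sup>2)" for p
  have "continuous_on S g"
    unfolding g_def by (intro continuous_intros cont)
  then obtain p where p: "p \<in> S" "\<And>p'. p' \<in> S \<Longrightarrow> g p \<le> g p'"
    using continuous_attains_inf[OF assms(1,3)] by blast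
  define d where "d i = max 0 (- f i p)" for i
  obtain p' where p': "p' \<in> S" "0 \<le> (\<Sum>i\<in>I. d i * f i p')"
    using comb[of d] by (auto simp: d_def)
  define \<delta> where "\<delta> i = f i p' - f i p" for i
  define D where "D = (\<Sum>i\<in>I. (\<delta> i)\<^sup>2)"
  have D: "0 \<le> D"
    by (simp add: D_def sum_nonneg)
  have "d i * f i p = - (d i)\<^sup>2" for i
    by (auto simp: d_def max_def power2_eq_square)
  then have slope: "g p \<le> (\<Sum>i\<in>I. d i * \<delta> i)"
    using p'(2) by (simp add: \<delta>_def g_def right_diff_distrib sum.distrib flip: d_def)
  \<comment> \<open>The negative part of f at the moved point is at most |d - s * \<delta>|, so g
    lies below a quadratic in s whose slope at 0 is at most -2 g(p).\<close>
  have bound: "g p \<le> g p - 2 * s * g p + s\<^sup>2 * D" if s: "0 \<le> s" "s \<le> 1" for s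
  proof -
    have "f i ((1 - s) *\<^sub>R p + s *\<^sub>R p') = f i p + s * \<delta> i" if "i \<in> I" for i
      using aff[OF that] by (simp add: \<delta>_def algebra_simps)
    moreover have "(max 0 (- (f i p + s * \<delta> i)))\<^sup>2 \<le> (d i - s * \<delta> i)\<^sup>2" for i
      by (subst abs_le_square_iff[symmetric]) (auto simp: d_def max_def)
    ultimately have "g ((1 - s) *\<^sub>R p + s *\<^sub>R p') \<le> (\<Sum>i\<in>I. (d i - s * \<delta> i)\<^sup>2)"
      unfolding g_def by (intro sum_mono) simp
    also have "\<dots> = g p - 2 * s * (\<Sum>i\<in>I. d i * \<delta> i) + s\<^sup>2 * D"
      unfolding g_def D_def d_def[symmetric]
      by (simp add: power2_diff sum.distrib sum_subtractf sum_distrib_left power_mult_distrib algebra_simps)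
    also have "\<dots> \<le> g p - 2 * s * g p + s\<^sup>2 * D"
      using slope s by (simp add: mult_left_mono)
    finally show ?thesis
      using p(2)[of "(1 - s) *\<^sub>R p + s *\<^sub>R p'"] p(1) p'(1) s assms(2)
      by (force intro: convexD_alt)
  qed
  have g0: "0 \<le> g p"
    by (simp add: g_def sum_nonneg)
  have "g p = 0"
  proof (rule ccontr)
    assume "g p \<noteq> 0"
    with g0 have gp: "0 < g p" by simp
    \<comment> \<open>Any s in (0,1] with s * D < 2 * g p yields the contradiction; this choice also
      covers D = 0.\<close>
    define s where "s = g p / (g p + D)"
    have s: "0 < s" "s \<le> 1"
      using gp D by (auto simp: s_def)
    have "2 * s * g p \<le> s\<^sup>2 * D"
      using bound[of s] s by simp
    then have "2 * g p \<le> s * D"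
      using s by (simp add: power2_eq_square)
    also have "s * D \<le> g p"
      using gp D by (simp add: s_def divide_simps)
    finally show False using gp by simp
  qed
  then have "\<forall>i\<in>I. (max 0 (- f i p))\<^sup>2 = 0"
    unfolding g_def using assms(4) by (subst (asm) sum_nonneg_eq_0_iff) auto
  then show ?thesis
    using p(1) by (intro bexI[of _ p]) (auto simp: max_def split: if_splits)
qed

text \<open>The finite case supplies the finite intersection property for the closed solution sets
  inside the compact set S.\<close>

lemma affine_inequalities_feasible:
  fixes S :: "'a::real_normed_vector set" and f :: "'i \<Rightarrow> 'a \<Rightarrow> real"
  assumes "compact S" "convex S" "S \<noteq> {}"
    and cont: "\<And>i. i \<in> I \<Longrightarrow> continuous_on S (f i)"
    and aff: "\<And>i p p' s. i \<in> I \<Longrightarrow> f i ((1 - s) *\<^sub>R p + s *\<^sub>R p') = (1 - s) * f i p + s * f i p'"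
    and comb: "\<And>J d. finite J \<Longrightarrow> J \<subseteq> I \<Longrightarrow> (\<And>i. i \<in> J \<Longrightarrow> 0 \<le> d i) \<Longrightarrow> \<exists>p\<in>S. 0 \<le> (\<Sum>i\<in>J. d i * f i p)"
  shows "\<exists>p\<in>S. \<forall>i\<in>I. 0 \<le> f i p"
proof -
  have "S \<inter> (\<Inter>i\<in>I. {p\<in>S. 0 \<le> f i p}) \<noteq> {}"
  proof (rule compact_imp_fip_image[OF assms(1)])
    show "closed {p\<in>S. 0 \<le> f i p}" if "i \<in> I" for i
      using continuous_closed_preimage[OF cont[OF that] compact_imp_closed[OF assms(1)], of "{0..}"]
      by (simp add: vimage_def Int_def)
    show "S \<inter> (\<Inter>i\<in>J. {p\<in>S. 0 \<le> f i p}) \<noteq> {}" if "finite J" "J \<subseteq> I" for J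
      using finite_affine_inequalities_feasible[OF assms(1-3) that(1), of f] cont aff comb[OF that] that(2)
      by (fastforce simp: subset_iff)
  qed
  then show ?thesis by blast
qed

section \<open>Semi-inner products\<close>

lemma norm_sum_mult_sq_le:
  fixes a b :: "'i \<Rightarrow> 'f::real_normed_field"
  shows "(norm (\<Sum>i\<in>I. a i * b i))\<^sup>2 \<le> (\<Sum>i\<in>I. (norm (a i))\<^sup>2) * (\<Sum>i\<in>I. (norm (b i))\<^sup>2)"
proof -
  have "norm (\<Sum>i\<in>I. a i * b i) \<le> (\<Sum>i\<in>I. norm (a i) * norm (b i))"
    by (rule order_trans[OF norm_sum]) (simp add: norm_mult)
  then have "(norm (\<Sum>i\<in>I. a i * b i))\<^sup>2 \<le> (\<Sum>i\<in>I. norm (a i) * norm (b i))\<^sup>2"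
    by (simp add: power_mono)
  also have "\<dots> \<le> (\<Sum>i\<in>I. (norm (a i))\<^sup>2) * (\<Sum>i\<in>I. (norm (b i))\<^sup>2)"
    by (rule Cauchy_Schwarz_ineq_sum)
  finally show ?thesis .
qed

text \<open>Common abstraction of the identity on the reals and of \<open>cnj\<close> on the complex
  numbers. The Euclidean structure provides real parts: \<open>inner x 1\<close> is the real part of
  x.\<close>

locale conjugation =
  fixes cj :: "'f::{real_normed_field, euclidean_space} \<Rightarrow> 'f"
  assumes cj_add: "cj (x + y) = cj x + cj y"
    and cj_mult: "cj (x * y) = cj x * cj y"
    and cj_cj [simp]: "cj (cj x) = x"
    and mult_cj: "x * cj x = of_real ((norm x)\<^sup>2)"
begin

lemma cj_0 [simp]: "cj 0 = 0"
  using cj_add[of 0 0] by simp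

lemma cj_of_real [simp]: "cj (of_real r) = of_real r"
proof (cases "r = 0")
  case False
  have "of_real r * cj (of_real r) = of_real r * (of_real r :: 'f)"
    using mult_cj[of "of_real r"] by (simp add: power2_eq_square)
  with False show ?thesis by simp
qed simp

lemma cj_1 [simp]: "cj 1 = 1"
  using cj_of_real[of 1] by simp

lemma cj_minus: "cj (- x) = - cj x"
  using cj_add[of x "- x"] by (simp add: add_eq_0_iff)

lemma cj_diff: "cj (x - y) = cj x - cj y"
  using cj_add[of x "- y"] by (simp add: cj_minus)

lemma cj_sum: "cj (\<Sum>i\<in>I. f i) = (\<Sum>i\<in>I. cj (f i))"
  by (induction I rule: infinite_finite_induct) (auto simp: cj_add)

lemma norm_cj [simp]: "norm (cj x) = norm x"
proof -
  have "of_real ((norm (cj x))\<^sup>2) = (of_real ((norm x)\<^sup>2) :: 'f)"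
    using mult_cj[of x] mult_cj[of "cj x"] by (simp add: mult.commute)
  then show ?thesis
    by (simp only: of_real_eq_iff) simp
qed

lemma bounded_linear_cj: "bounded_linear cj"
  by (rule bounded_linear_intro[where K = 1]) (auto simp: cj_add cj_mult scaleR_conv_of_real)

lemma continuous_on_cj [continuous_intros]: "continuous_on S f \<Longrightarrow> continuous_on S (\<lambda>x. cj (f x))"
  by (rule bounded_linear.continuous_on[OF bounded_linear_cj])

text \<open>Expanding the square of norm (x + 1) once with the conjugation and once with the real
  inner product ties the two structures together.\<close>

lemma add_cj: "x + cj x = of_real (2 * inner x 1)"
proof -
  have "of_real ((norm (x + 1))\<^sup>2) = of_real ((norm x)\<^sup>2) + (x + cj x) + 1"
    unfolding mult_cj[symmetric] by (simp add: cj_add algebra_simps)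
  moreover have "(norm (x + 1))\<^sup>2 = (norm x)\<^sup>2 + 2 * inner x 1 + 1"
    unfolding power2_norm_eq_inner
    by (simp add: inner_add_left inner_add_right inner_commute norm_eq_1[THEN iffD1])
  ultimately have "of_real ((norm x)\<^sup>2 + 2 * inner x 1 + 1) = of_real ((norm x)\<^sup>2) + (x + cj x) + 1"
    by simp
  then show ?thesis
    by simp
qed

lemma inner_of_real_1 [simp]: "inner (of_real r :: 'f) 1 = r"
  using norm_eq_1[of "1::'f"] by (simp add: of_real_def)

end

text \<open>A positive semidefinite Hermitian form on a space of functions. Degeneracy is allowed
  because the L_2 form of a measure may vanish on nonzero functions. The assumption
  \<open>self_norm\<close> encodes that \<open>s x x\<close> is real and nonnegative.\<close>

locale semi_inner = conjugation cj
  for cj :: "'f::{real_normed_field, euclidean_space} \<Rightarrow> 'f" +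
  fixes V :: "('a::topological_space \<Rightarrow>\<^sub>C 'f) set"
    and s :: "('a \<Rightarrow>\<^sub>C 'f) \<Rightarrow> ('a \<Rightarrow>\<^sub>C 'f) \<Rightarrow> 'f"
  assumes subspace: "CK.subspace V"
    and add_left: "x \<in> V \<Longrightarrow> y \<in> V \<Longrightarrow> z \<in> V \<Longrightarrow> s (x + y) z = s x z + s y z"
    and scale_left: "x \<in> V \<Longrightarrow> y \<in> V \<Longrightarrow> s (scaleF c x) y = c * s x y"
    and commute: "x \<in> V \<Longrightarrow> y \<in> V \<Longrightarrow> s y x = cj (s x y)"
    and self_norm: "x \<in> V \<Longrightarrow> s x x = of_real (norm (s x x))"
begin

definition sq :: "('a \<Rightarrow>\<^sub>C 'f) \<Rightarrow> real" where
  "sq x = norm (s x x)"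

lemmas closed [simp, intro] =
  CK.subspace_0[OF subspace] CK.subspace_add[OF subspace] CK.subspace_diff[OF subspace]
  CK.subspace_scale[OF subspace] CK.subspace_sum[OF subspace]

lemma sq_nonneg [simp]: "0 \<le> sq x"
  by (simp add: sq_def)

lemma self: "x \<in> V \<Longrightarrow> s x x = of_real (sq x)"
  unfolding sq_def by (rule self_norm)

lemma sq_eqI: "x \<in> V \<Longrightarrow> s x x = of_real r \<Longrightarrow> sq x = r"
  by (metis of_real_eq_iff self)

lemma add_right: "x \<in> V \<Longrightarrow> y \<in> V \<Longrightarrow> z \<in> V \<Longrightarrow> s z (x + y) = s z x + s z y"
  using commute[of "x + y" z] commute[of x z] commute[of y z] by (simp add: add_left cj_add)

lemma scale_right: "x \<in> V \<Longrightarrow> y \<in> V \<Longrightarrow> s x (scaleF c y) = cj c * s x y"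
  using commute[of "scaleF c y" x] commute[of y x] by (simp add: scale_left cj_mult)

lemma zero_left [simp]: "y \<in> V \<Longrightarrow> s 0 y = 0"
  using add_left[of 0 0 y] by simp

lemma zero_right [simp]: "y \<in> V \<Longrightarrow> s y 0 = 0"
  using add_right[of 0 0 y] by simp

lemma diff_left: "x \<in> V \<Longrightarrow> y \<in> V \<Longrightarrow> z \<in> V \<Longrightarrow> s (x - y) z = s x z - s y z"
  using add_left[of "x - y" y z] by simp

lemma sum_left: "(\<And>i. i \<in> I \<Longrightarrow> f i \<in> V) \<Longrightarrow> y \<in> V \<Longrightarrow> s (\<Sum>i\<in>I. f i) y = (\<Sum>i\<in>I. s (f i) y)"
  by (induction I rule: infinite_finite_induct) (auto simp: add_left)

lemma sum_right: "(\<And>i. i \<in> I \<Longrightarrow> f i \<in> V) \<Longrightarrow> y \<in> V \<Longrightarrow> s y (\<Sum>i\<in>I. f i) = (\<Sum>i\<in>I. s y (f i))"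
  by (induction I rule: infinite_finite_induct) (auto simp: add_right)

lemma sq_scale: "x \<in> V \<Longrightarrow> sq (scaleF c x) = (norm c)\<^sup>2 * sq x"
  unfolding sq_def by (simp add: scale_left scale_right norm_mult power2_eq_square)

lemma sq_add: "x \<in> V \<Longrightarrow> y \<in> V \<Longrightarrow> sq (x + y) = sq x + sq y + 2 * inner (s x y) 1"
proof (intro sq_eqI)
  assume "x \<in> V" "y \<in> V"
  then have "s (x + y) (x + y) = of_real (sq x) + of_real (sq y) + (s x y + cj (s x y))"
    using commute[of x y] by (simp add: add_left add_right flip: self)
  then show "s (x + y) (x + y) = of_real (sq x + sq y + 2 * inner (s x y) 1)"
    by (simp add: add_cj)
qed simp

lemma cauchy_schwarz:
  assumes x: "x \<in> V" and y: "y \<in> V"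
  shows "(norm (s x y))\<^sup>2 \<le> sq x * sq y"
proof -
  define N where "N = (norm (s x y))\<^sup>2"
  have quadratic: "0 \<le> sq x - 2 * r * N + r\<^sup>2 * N * sq y" for r
  proof -
    \<comment> \<open>The factor \<open>s x y\<close> turns the cross term of
      \<open>sq (x + scaleF c y)\<close> into a real number.\<close>
    define c where "c = - of_real r * s x y"
    have "s x (scaleF c y) = cj c * s x y"
      by (rule scale_right[OF x y])
    also have "\<dots> = - of_real r * (s x y * cj (s x y))"
      by (simp add: c_def cj_mult cj_minus)
    also have "\<dots> = of_real (- r * N)"
      by (simp add: mult_cj N_def)
    finally have "s x (scaleF c y) = of_real (- r * N)" .
    then have "inner (s x (scaleF c y)) 1 = - r * N"
      by (simp only: inner_of_real_1)
    moreover have "(norm c)\<^sup>2 = r\<^sup>2 * N"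
      by (simp add: c_def N_def norm_mult power_mult_distrib)
    ultimately have "sq (x + scaleF c y) = sq x - 2 * r * N + r\<^sup>2 * N * sq y"
      using x y by (simp add: sq_add sq_scale)
    then show ?thesis
      by (metis sq_nonneg)
  qed
  show ?thesis
  proof (cases "sq y = 0")
    case True
    \<comment> \<open>For null y the inequality is affine in r with slope -2N, so a large r is
      contradictory unless N = 0.\<close>
    have "N = 0"
    proof (rule ccontr)
      assume "N \<noteq> 0"
      then have "0 \<le> sq x - (sq x + 1)"
        using quadratic[of "(sq x + 1) / (2 * N)"] True by simp
      then show False by simp
    qed
    then show ?thesis
      using True by (simp add: N_def)
  next
    case False
    then have pos: "0 < sq y"
      using sq_nonneg[of y] by linarith
    have "0 \<le> sq x - N / sq y"
      using quadratic[of "1 / sq y"] pos by (simp add: power2_eq_square)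
    then show ?thesis
      using pos by (simp add: N_def pos_divide_le_eq)
  qed
qed

lemma null_left: "x \<in> V \<Longrightarrow> y \<in> V \<Longrightarrow> sq x = 0 \<Longrightarrow> s x y = 0"
  using cauchy_schwarz[of x y] by simp

lemma null_right: "x \<in> V \<Longrightarrow> y \<in> V \<Longrightarrow> sq y = 0 \<Longrightarrow> s x y = 0"
  using cauchy_schwarz[of x y] by simp

lemma sq_null_add: "x \<in> V \<Longrightarrow> y \<in> V \<Longrightarrow> sq y = 0 \<Longrightarrow> sq (x + y) = sq x"
  by (simp add: sq_add null_right)

lemma sq_null_diff: "x \<in> V \<Longrightarrow> y \<in> V \<Longrightarrow> sq (x - y) = 0 \<Longrightarrow> sq x = sq y"
  using sq_null_add[of y "x - y"] by simp

lemma subspace_null: "CK.subspace {x \<in> V. sq x = 0}"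
  by (rule CK.subspaceI) (auto simp: sq_null_add sq_scale, simp add: sq_def)

text \<open>Expand only the first argument of \<open>s z z\<close>, apply Cauchy-Schwarz to the sum
  and to each term, and cancel one factor \<open>sq z\<close>.\<close>

lemma sq_sum_scale_le:
  assumes e: "\<And>i. i \<in> I \<Longrightarrow> e i \<in> V"
  shows "sq (\<Sum>i\<in>I. scaleF (c i) (e i)) \<le> (\<Sum>i\<in>I. (norm (c i))\<^sup>2) * (\<Sum>i\<in>I. sq (e i))"
proof -
  define z where "z = (\<Sum>i\<in>I. scaleF (c i) (e i))"
  have z: "z \<in> V"
    using e by (auto simp: z_def)
  have "s z z = (\<Sum>i\<in>I. c i * s (e i) z)"
    using e z by (subst z_def, subst sum_left) (auto simp: scale_left)
  then have "(sq z)\<^sup>2 \<le> (\<Sum>i\<in>I. (norm (c i))\<^sup>2) * (\<Sum>i\<in>I. (norm (s (e i) z))\<^sup>2)"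
    using norm_sum_mult_sq_le[of c "\<lambda>i. s (e i) z" I] by (simp add: sq_def)
  also have "\<dots> \<le> (\<Sum>i\<in>I. (norm (c i))\<^sup>2) * (\<Sum>i\<in>I. sq (e i) * sq z)"
    using e z by (intro mult_left_mono sum_mono cauchy_schwarz sum_nonneg) auto
  also have "\<dots> = (\<Sum>i\<in>I. (norm (c i))\<^sup>2) * (\<Sum>i\<in>I. sq (e i)) * sq z"
    by (simp add: mult.assoc flip: sum_distrib_right)
  finally have le: "sq z * sq z \<le> (\<Sum>i\<in>I. (norm (c i))\<^sup>2) * (\<Sum>i\<in>I. sq (e i)) * sq z"
    by (simp add: power2_eq_square)
  show ?thesis
  proof (cases "sq z = 0")
    case True
    then show ?thesis
      by (simp add: z_def sum_nonneg)
  next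
    case False
    then have "0 < sq z"
      using sq_nonneg[of z] by linarith
    then show ?thesis
      using le by (simp add: z_def)
  qed
qed

definition orthonormal :: "nat \<Rightarrow> (nat \<Rightarrow> 'a \<Rightarrow>\<^sub>C 'f) \<Rightarrow> bool" where
  "orthonormal d e \<longleftrightarrow>
     (\<forall>i<d. e i \<in> V) \<and> (\<forall>i<d. \<forall>j<d. s (e i) (e j) = (if i = j then 1 else 0))"

definition proj :: "nat \<Rightarrow> (nat \<Rightarrow> 'a \<Rightarrow>\<^sub>C 'f) \<Rightarrow> ('a \<Rightarrow>\<^sub>C 'f) \<Rightarrow> ('a \<Rightarrow>\<^sub>C 'f)" where
  "proj d e x = (\<Sum>i<d. scaleF (s x (e i)) (e i))"

lemma proj_in: "CK.subspace W \<Longrightarrow> (\<And>i. i < d \<Longrightarrow> e i \<in> W) \<Longrightarrow> proj d e x \<in> W"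
  unfolding proj_def by (auto intro!: CK.subspace_sum CK.subspace_scale)

context
  fixes d e
  assumes on: "orthonormal d e"
begin

lemma proj_closed [simp]: "proj d e x \<in> V"
  using on subspace by (auto intro!: proj_in simp: orthonormal_def)

lemma proj_add: "x \<in> V \<Longrightarrow> y \<in> V \<Longrightarrow> proj d e (x + y) = proj d e x + proj d e y"
  using on by (simp add: proj_def orthonormal_def add_left CK.scale_left_distrib sum.distrib)

lemma proj_scale: "x \<in> V \<Longrightarrow> proj d e (scaleF c x) = scaleF c (proj d e x)"
  using on by (simp add: proj_def orthonormal_def scale_left CK.scale_sum_right)

lemma coeff_orthonormal_sum:
  assumes "j < d"
  shows "s (\<Sum>i<d. scaleF (a i) (e i)) (e j) = a j"
proof -
  have "s (\<Sum>i<d. scaleF (a i) (e i)) (e j) = (\<Sum>i<d. a i * s (e i) (e j))"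
    using on assms by (subst sum_left) (auto simp: orthonormal_def scale_left)
  also have "\<dots> = (\<Sum>i<d. if i = j then a i else 0)"
    using on assms by (intro sum.cong) (auto simp: orthonormal_def)
  finally show ?thesis
    using assms by simp
qed

lemma sq_orthonormal_sum: "sq (\<Sum>i<d. scaleF (a i) (e i)) = (\<Sum>i<d. (norm (a i))\<^sup>2)"
proof (rule sq_eqI)
  let ?z = "\<Sum>i<d. scaleF (a i) (e i)"
  show z: "?z \<in> V"
    using on by (auto simp: orthonormal_def)
  have "s ?z ?z = (\<Sum>i<d. cj (a i) * s ?z (e i))"
    using on z by (subst sum_right) (auto simp: orthonormal_def scale_right)
  also have "\<dots> = (\<Sum>i<d. a i * cj (a i))"
    by (simp add: coeff_orthonormal_sum mult.commute)
  finally show "s ?z ?z = of_real (\<Sum>i<d. (norm (a i))\<^sup>2)"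
    by (simp add: mult_cj flip: of_real_power)
qed

lemma proj_coeff: "j < d \<Longrightarrow> s (proj d e x) (e j) = s x (e j)"
  unfolding proj_def by (rule coeff_orthonormal_sum)

lemma residual_orthogonal: "x \<in> V \<Longrightarrow> s (x - proj d e x) (proj d e y) = 0"
  using on unfolding proj_def[of d e y]
  by (subst sum_right) (auto simp: orthonormal_def scale_right diff_left proj_coeff)

lemma proj_idem: "x \<in> V \<Longrightarrow> proj d e (proj d e x) = proj d e x"
  unfolding proj_def[of d e "proj d e x"] by (simp add: proj_coeff) (simp add: proj_def)

lemma sq_proj: "sq (proj d e x) = (\<Sum>i<d. (norm (s x (e i)))\<^sup>2)"
  unfolding proj_def by (rule sq_orthonormal_sum)

lemma pythagoras:
  assumes "x \<in> V"
  shows "sq x = sq (proj d e x) + sq (x - proj d e x)"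
  using sq_add[of "x - proj d e x" "proj d e x"] residual_orthogonal[of x x] assms by simp

lemma bessel: "x \<in> V \<Longrightarrow> (\<Sum>i<d. (norm (s x (e i)))\<^sup>2) \<le> sq x"
  using pythagoras[of x] sq_proj[of x] by simp

end

text \<open>Orthonormalisation for a degenerate form. A vector whose residual is null contributes no
  new basis element, whence d may be smaller than \<open>card B\<close> and the expansion holds only
  up to null vectors.\<close>

lemma gram_schmidt:
  assumes "finite B" "B \<subseteq> V"
  shows "\<exists>d e. d \<le> card B \<and> orthonormal d e \<and> (\<forall>i<d. e i \<in> CK.span B) \<and>
           (\<forall>x\<in>CK.span B. sq (x - proj d e x) = 0)"
  using assms
proof (induction B rule: finite_induct)
  case empty
  show ?case
    by (intro exI[of _ 0]) (auto simp: orthonormal_def proj_def sq_def)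
next
  case (insert b B)
  then obtain d e where IH: "d \<le> card B" "orthonormal d e" "\<And>i. i < d \<Longrightarrow> e i \<in> CK.span B"
    "\<And>x. x \<in> CK.span B \<Longrightarrow> sq (x - proj d e x) = 0"
    by auto
  note [simp] = proj_closed[OF IH(2)]
  have b: "b \<in> V" and spanV: "x \<in> CK.span B \<Longrightarrow> x \<in> V" for x
    using insert.prems CK.span_minimal[OF _ subspace, of B] by auto
  have sub: "x \<in> CK.span B \<Longrightarrow> x \<in> CK.span (insert b B)" for x
    using CK.span_mono[of B "insert b B"] by auto
  define y where "y = b - proj d e b"
  have y: "y \<in> V"
    using b by (simp add: y_def)
  have y_span: "y \<in> CK.span (insert b B)"
    unfolding y_def using IH(3)
    by (intro CK.span_diff CK.span_base[of b] sub proj_in) auto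
  have y_orth: "s y (e i) = 0" if "i < d" for i
    using that b IH(2) by (auto simp: y_def diff_left proj_coeff[OF IH(2)] orthonormal_def)
  have y_orth': "s (e i) y = 0" if "i < d" for i
    using y_orth[OF that] that y commute[of y "e i"] IH(2) by (simp add: orthonormal_def)
  have decomp: "\<exists>k z. x = scaleF k b + z \<and> z \<in> CK.span B" if "x \<in> CK.span (insert b B)" for x
    using that by (auto simp: CK.span_breakdown_eq) (metis add_diff_cancel_left' diff_add_cancel add.commute)
  show ?case
  proof (cases "sq y = 0")
    case True
    have "sq (x - proj d e x) = 0" if "x \<in> CK.span (insert b B)" for x
    proof -
      obtain k z where x: "x = scaleF k b + z" "z \<in> CK.span B"
        using decomp[OF \<open>x \<in> _\<close>] by blast
      have "x - proj d e x = scaleF k y + (z - proj d e z)"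
        using b spanV[OF x(2)] unfolding x(1) y_def
        by (simp add: proj_add[OF IH(2)] proj_scale[OF IH(2)] CK.scale_right_diff_distrib)
      then show ?thesis
        using True y IH(4)[OF x(2)] spanV[OF x(2)] by (simp add: sq_null_add sq_scale)
    qed
    then show ?thesis
      using IH insert.hyps sub by (intro exI[of _ d] exI[of _ e]) auto
  next
    case False
    then have pos: "0 < sq y"
      using sq_nonneg[of y] by linarith
    define c :: 'f where "c = of_real (1 / sqrt (sq y))"
    define e' where "e' = e(d := scaleF c y)"
    have e'_lt: "e' i = e i" if "i < d" for i
      using that by (simp add: e'_def)
    have e'_d: "e' d = scaleF c y"
      by (simp add: e'_def)
    have cc: "c * c * of_real (sq y) = 1" "cj c = c" "c \<noteq> 0"
      using pos cj_of_real[of "1 / sqrt (sq y)"] by (auto simp: c_def simp flip: of_real_mult)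
    have "s (scaleF c y) (scaleF c y) = c * (cj c * s y y)"
      using y scale_left[of y "scaleF c y" c] scale_right[of y y c] by simp
    then have unit: "s (scaleF c y) (scaleF c y) = 1"
      using cc y by (simp add: self mult.assoc)
    have on': "orthonormal (Suc d) e'"
      using IH(2) y y_orth y_orth' unit
      by (auto simp: orthonormal_def e'_def less_Suc_eq scale_left scale_right)
    have e'_span: "e' i \<in> CK.span (insert b B)" if "i < Suc d" for i
      using that IH(3) y_span sub by (auto simp: e'_def less_Suc_eq intro: CK.span_scale)
    have proj_Suc: "proj (Suc d) e' x = proj d e x + scaleF (s x (e' d)) (e' d)" for x
      by (simp add: proj_def e'_lt)
    have "sq (x - proj (Suc d) e' x) = 0" if "x \<in> CK.span (insert b B)" for x
    proof -
      obtain k z where x: "x = scaleF k b + z" "z \<in> CK.span B"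
        using decomp[OF \<open>x \<in> _\<close>] by blast
      have zV: "z \<in> V"
        by (rule spanV[OF x(2)])
      have orth: "s (proj d e w) y = 0" if "w \<in> V" for w
        unfolding proj_def using that y y_orth' IH(2)
        by (subst sum_left) (auto simp: orthonormal_def scale_left)
      \<comment> \<open>z equals its projection only up to a null vector, but null vectors are
        orthogonal to everything. Hence z has no component along y, and the enlarged system leaves
        of x exactly the null residual of z.\<close>
      have "s (z - proj d e z) y = 0"
        using zV y IH(4)[OF x(2)] by (intro null_left) auto
      then have zy: "s z y = 0"
        using zV y orth[OF zV] by (simp add: diff_left)
      have "s b y = s (y + proj d e b) y"
        by (simp add: y_def)
      then have "s b y = of_real (sq y)"
        using y orth[OF b] by (simp add: add_left self)
      then have "s x (e' d) = k * c * of_real (sq y)"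
        using zy zV y b by (simp add: x(1) e'_d scale_right scale_left add_left cc(2))
      then have "scaleF (s x (e' d)) (e' d) = scaleF (k * (c * c * of_real (sq y))) y"
        by (simp only: e'_d CK.scale_scale) (simp add: mult_ac)
      then have "scaleF (s x (e' d)) (e' d) = scaleF k y"
        by (simp add: cc(1))
      then have "x - proj (Suc d) e' x = z - proj d e z"
        using b zV unfolding proj_Suc
        by (simp add: x(1) y_def proj_add[OF IH(2)] proj_scale[OF IH(2)] CK.scale_right_diff_distrib)
      then show ?thesis
        using IH(4)[OF x(2)] by simp
    qed
    then show ?thesis
      using on' e'_span IH(1) insert.hyps by (intro exI[of _ "Suc d"] exI[of _ e']) auto
  qed
qed

text \<open>Expand x in an s-orthonormal basis. The residual is null for s, hence for h, so that
  only the coefficients matter, and Bessel bounds these. The constant is the trace of h in that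
  basis.\<close>

lemma dominates:
  assumes "semi_inner cj V h" "finite B" "V = CK.span B"
    and null: "\<And>x. x \<in> V \<Longrightarrow> sq x = 0 \<Longrightarrow> h x x = 0"
  shows "\<exists>C\<ge>0. \<forall>x\<in>V. norm (h x x) \<le> C * sq x"
proof -
  interpret H: semi_inner cj V h
    by (rule assms(1))
  have "B \<subseteq> V"
    using assms(3) CK.span_superset by auto
  then obtain d e where e: "orthonormal d e" "\<And>x. x \<in> V \<Longrightarrow> sq (x - proj d e x) = 0"
    using gram_schmidt[OF assms(2)] assms(3) by blast
  note [simp] = proj_closed[OF e(1)]
  have "H.sq x \<le> (\<Sum>i<d. H.sq (e i)) * sq x" if x: "x \<in> V" for x
  proof -
    have "H.sq (x - proj d e x) = 0"
      using null[of "x - proj d e x"] e(2) x by (simp add: H.sq_def)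
    then have "H.sq x = H.sq (proj d e x)"
      using x by (intro H.sq_null_diff) auto
    also have "\<dots> \<le> (\<Sum>i<d. (norm (s x (e i)))\<^sup>2) * (\<Sum>i<d. H.sq (e i))"
      unfolding proj_def using e(1) by (intro H.sq_sum_scale_le) (auto simp: orthonormal_def)
    also have "\<dots> \<le> sq x * (\<Sum>i<d. H.sq (e i))"
      using bessel[OF e(1) x] by (intro mult_right_mono sum_nonneg) auto
    finally show ?thesis
      by (simp add: mult.commute)
  qed
  then show ?thesis
    by (intro exI[of _ "\<Sum>i<d. H.sq (e i)"]) (auto simp: sum_nonneg H.sq_def)
qed

end

section \<open>The norm \<open>\<pi>\<^sub>2\<close> on subspaces of \<open>C(K)\<close>\<close>

lemma apply_bcontfun_sum: "apply_bcontfun (\<Sum>i\<in>I. f i) t = (\<Sum>i\<in>I. apply_bcontfun (f i) t)"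
  by (induction I rule: infinite_finite_induct) auto

lemma opnorm_le_mult:
  assumes "0 \<le> a" "\<And>x. x \<in> vecs E \<Longrightarrow> vnorm F (T x) \<le> a * vnorm G (S x)"
  shows "opnorm E F T \<le> ennreal a * opnorm E G S"
  unfolding opnorm_def
proof (rule SUP_least)
  fix x assume x: "x \<in> {x \<in> vecs E. vnorm E x \<le> 1}"
  then have "ennreal (vnorm F (T x)) \<le> ennreal a * ennreal (vnorm G (S x))"
    using assms by (auto simp: ennreal_mult'[symmetric] intro!: ennreal_leI)
  also have "\<dots> \<le> ennreal a * (SUP x\<in>{x \<in> vecs E. vnorm E x \<le> 1}. ennreal (vnorm G (S x)))"
    using x by (intro mult_left_mono SUP_upper) auto
  finally show "ennreal (vnorm F (T x)) \<le> \<dots>" .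
qed

text \<open>For finite I this is the pointwise form of norm at most 1 for the operator from l_2 into
  C(K) that sends the unit vectors to the w_i. The index set is arbitrary because the Pietsch
  argument indexes families by functions.\<close>

definition contractive :: "'i set \<Rightarrow> ('i \<Rightarrow> 'a::topological_space \<Rightarrow>\<^sub>C 'f::real_normed_field) \<Rightarrow> bool" where
  "contractive I w \<longleftrightarrow> (\<forall>t. (\<Sum>i\<in>I. (norm (apply_bcontfun (w i) t))\<^sup>2) \<le> 1)"

lemma linear_op_ell2_expand:
  fixes U :: "(nat \<Rightarrow> 'f::real_normed_field) \<Rightarrow> ('a::topological_space \<Rightarrow>\<^sub>C 'f)"
  assumes U: "linear_op (ell2 m) (sub_CK X) U" and a: "a \<in> vecs (ell2 m)"
  shows "U a = (\<Sum>i<m. scaleF (a i) (U (unit_vec i)))"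
proof -
  have lin: "U (\<lambda>i. x i + y i) = U x + U y" "U (\<lambda>i. c * x i) = scaleF c (U x)"
    if "\<forall>i\<ge>m. x i = 0" "\<forall>i\<ge>m. y i = 0" for x y c
    using U that by (auto simp: linear_op_def ell2_def sub_CK_def)
  have "U (\<lambda>i. if i < j then a i else 0) = (\<Sum>i<j. scaleF (a i) (U (unit_vec i)))" if "j \<le> m" for j
    using that
  proof (induction j)
    case 0
    show ?case
      using lin(2)[of "\<lambda>_. 0" "\<lambda>_. 0" 0] by simp
  next
    case (Suc j)
    have "(\<lambda>i. if i < Suc j then a i else 0) =
        (\<lambda>i. (if i < j then a i else 0) + a j * unit_vec j i)"
      by (auto simp: unit_vec_def less_Suc_eq)
    moreover have "U (\<lambda>i. (if i < j then a i else 0) + a j * unit_vec j i) =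
        U (\<lambda>i. if i < j then a i else 0) + U (\<lambda>i. a j * unit_vec j i)"
      using Suc.prems by (intro lin(1)) (auto simp: unit_vec_def)
    moreover have "U (\<lambda>i. a j * unit_vec j i) = scaleF (a j) (U (unit_vec j))"
      using Suc.prems by (intro lin(2)) (auto simp: unit_vec_def)
    ultimately show ?case
      using Suc by simp
  qed
  moreover have "(\<lambda>i. if i < m then a i else 0) = a"
    using a by (auto simp: ell2_def)
  ultimately show ?thesis
    by (metis order_refl)
qed

lemma linear_op_ell2_sum:
  fixes w :: "nat \<Rightarrow> 'a::topological_space \<Rightarrow>\<^sub>C 'f::real_normed_field"
  assumes "CK.subspace X" "\<And>i. i < m \<Longrightarrow> w i \<in> X"
  shows "linear_op (ell2 m) (sub_CK X) (\<lambda>a. \<Sum>i<m. scaleF (a i) (w i))"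
  using assms
  by (auto simp: linear_op_def ell2_def sub_CK_def CK.scale_left_distrib sum.distrib CK.scale_sum_right
      intro!: CK.subspace_sum CK.subspace_scale)

lemma sum_scaleF_unit_vec: "i < m \<Longrightarrow> (\<Sum>j<m. scaleF (unit_vec i j) (w j)) = w i"
  by (subst sum.remove[of _ i]) (auto simp: unit_vec_def intro!: sum.neutral)

context conjugation
begin

lemma opnorm_ell2_le_1_iff:
  fixes U :: "(nat \<Rightarrow> 'f) \<Rightarrow> ('a::topological_space \<Rightarrow>\<^sub>C 'f)"
  assumes U: "linear_op (ell2 m) (sub_CK X) U"
  shows "opnorm (ell2 m) (sub_CK X) U \<le> 1 \<longleftrightarrow> contractive {..<m} (\<lambda>i. U (unit_vec i))"
    (is "?L \<longleftrightarrow> ?R")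
proof
  assume L: ?L
  have bound: "norm (U a) \<le> 1" if "a \<in> vecs (ell2 m)" "vnorm (ell2 m) a \<le> 1" for a
  proof -
    have "ennreal (vnorm (sub_CK X) (U a)) \<le> opnorm (ell2 m) (sub_CK X) U"
      unfolding opnorm_def using that by (intro SUP_upper) auto
    then have "ennreal (vnorm (sub_CK X) (U a)) \<le> 1"
      using L by (rule order_trans)
    then show ?thesis by (simp add: sub_CK_def)
  qed
  show ?R
    unfolding contractive_def
  proof
    fix t
    define S where "S = (\<Sum>i<m. (norm (apply_bcontfun (U (unit_vec i)) t))\<^sup>2)"
    have S0: "0 \<le> S"
      by (simp add: S_def sum_nonneg)
    show "(\<Sum>i<m. (norm (apply_bcontfun (U (unit_vec i)) t))\<^sup>2) \<le> 1"
    proof (cases "S = 0")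
      case False
      \<comment> \<open>The extremal vector of Cauchy-Schwarz at the point t: on it the value of
        \<open>U a\<close> at t is sqrt S.\<close>
      define a where "a i = (if i < m then cj (apply_bcontfun (U (unit_vec i)) t) / of_real (sqrt S) else 0)" for i
      have a: "a \<in> vecs (ell2 m)"
        by (simp add: a_def ell2_def)
      have "(\<Sum>i<m. (norm (a i))\<^sup>2) = (\<Sum>i<m. (norm (apply_bcontfun (U (unit_vec i)) t))\<^sup>2 / S)"
        using S0 by (simp add: a_def norm_divide power_divide)
      also have "\<dots> = S / S"
        by (simp only: S_def sum_divide_distrib)
      finally have "(\<Sum>i<m. (norm (a i))\<^sup>2) = S / S" .
      then have "vnorm (ell2 m) a \<le> 1"
        using False by (simp add: ell2_def L2_set_def)
      then have "norm (apply_bcontfun (U a) t) \<le> 1"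
        using bound[OF a] norm_bounded[of "U a" t] by linarith
      moreover have "apply_bcontfun (U a) t = (\<Sum>i<m. a i * apply_bcontfun (U (unit_vec i)) t)"
        using linear_op_ell2_expand[OF U a] by (simp add: apply_bcontfun_sum)
      moreover have "\<dots> = (\<Sum>i<m. of_real ((norm (apply_bcontfun (U (unit_vec i)) t))\<^sup>2)) / of_real (sqrt S)"
        unfolding sum_divide_distrib
        by (intro sum.cong) (auto simp: a_def mult_cj mult.commute[of "cj _"] simp flip: of_real_power)
      moreover have "\<dots> = of_real (S / sqrt S)"
        by (simp add: S_def)
      ultimately have "S / sqrt S \<le> 1"
        using S0 by (simp del: of_real_divide)
      then show ?thesis
        using S0 by (simp add: real_div_sqrt flip: S_def)
    qed (simp add: S_def)
  qed
next
  assume R: ?R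
  show ?L
    unfolding opnorm_def
  proof (rule SUP_least)
    fix a :: "nat \<Rightarrow> 'f" assume a: "a \<in> {x \<in> vecs (ell2 m). vnorm (ell2 m) x \<le> 1}"
    have "norm (U a) \<le> 1"
    proof (rule norm_bound)
      fix t
      have "apply_bcontfun (U a) t = (\<Sum>i<m. a i * apply_bcontfun (U (unit_vec i)) t)"
        using linear_op_ell2_expand[OF U, of a] a by (simp add: apply_bcontfun_sum)
      then have "(norm (apply_bcontfun (U a) t))\<^sup>2 \<le>
          (\<Sum>i<m. (norm (a i))\<^sup>2) * (\<Sum>i<m. (norm (apply_bcontfun (U (unit_vec i)) t))\<^sup>2)"
        by (simp only: norm_sum_mult_sq_le)
      also have "\<dots> \<le> 1 * 1"
        using a R by (intro mult_mono) (auto simp: ell2_def L2_set_def contractive_def sum_nonneg)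
      finally show "norm (apply_bcontfun (U a) t) \<le> 1"
        by (simp add: abs_square_le_1)
    qed
    then show "ennreal (vnorm (sub_CK X) (U a)) \<le> 1"
      by (simp add: sub_CK_def)
  qed
qed

text \<open>Operators U and families w_i = U e_i determine each other, which turns \<pi>_2 into a
  supremum over families of functions.\<close>

lemma pi2_sub_CK:
  fixes X :: "('a::topological_space \<Rightarrow>\<^sub>C 'f) set"
  assumes X: "CK.subspace X"
  shows "pi2 (sub_CK X) F T =
    (SUP (m, w)\<in>{(m :: nat, w). 1 \<le> m \<and> (\<forall>i<m. w i \<in> X) \<and> contractive {..<m} w}.
       ennreal (sqrt (\<Sum>i<m. (vnorm F (T (w i)))\<^sup>2)))" (is "_ = (SUP (m, w)\<in>?W. ?g m w)")
  unfolding pi2_def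
proof (intro antisym SUP_least; clarify)
  fix m and U :: "(nat \<Rightarrow> 'f) \<Rightarrow> ('a \<Rightarrow>\<^sub>C 'f)"
  assume m: "1 \<le> m" and U: "linear_op (ell2 m) (sub_CK X) U" "opnorm (ell2 m) (sub_CK X) U \<le> 1"
  have "U (unit_vec i) \<in> X" if "i < m" for i
    using U(1) that by (auto simp: linear_op_def sub_CK_def ell2_def unit_vec_def)
  then have "(m, \<lambda>i. U (unit_vec i)) \<in> ?W"
    using m U opnorm_ell2_le_1_iff[OF U(1)] by auto
  then show "?g m (\<lambda>i. U (unit_vec i)) \<le> (SUP (m, w)\<in>?W. ?g m w)"
    by (rule SUP_upper2) simp
next
  fix m :: nat and w :: "nat \<Rightarrow> 'a \<Rightarrow>\<^sub>C 'f"
  assume m: "1 \<le> m" and w: "\<forall>i<m. w i \<in> X" "contractive {..<m} w"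
  define U where "U a = (\<Sum>i<m. scaleF (a i) (w i))" for a
  have U: "linear_op (ell2 m) (sub_CK X) U"
    unfolding U_def using linear_op_ell2_sum[OF X, of m w] w(1) by auto
  have Uw: "U (unit_vec i) = w i" if "i < m" for i
    using sum_scaleF_unit_vec[OF that] by (simp add: U_def)
  then have "opnorm (ell2 m) (sub_CK X) U \<le> 1"
    unfolding opnorm_ell2_le_1_iff[OF U] using w(2) by (simp add: contractive_def)
  then show "?g m w \<le> (SUP (m, U)\<in>{(m, U). 1 \<le> m \<and> linear_op (ell2 m) (sub_CK X) U \<and>
      opnorm (ell2 m) (sub_CK X) U \<le> 1}. ennreal (sqrt (\<Sum>i<m. (vnorm F (T (U (unit_vec i))))\<^sup>2)))"
    using m U Uw by (intro SUP_upper2[of "(m, U)"]) auto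
qed

lemma pi2_lower:
  fixes X :: "('a::topological_space \<Rightarrow>\<^sub>C 'f) set"
  assumes X: "CK.subspace X" and "finite I" and w: "\<And>i. i \<in> I \<Longrightarrow> w i \<in> X" "contractive I w"
  shows "ennreal (sqrt (\<Sum>i\<in>I. (vnorm F (T (w i)))\<^sup>2)) \<le> pi2 (sub_CK X) F T"
proof (cases "I = {}")
  case False
  define m where "m = card I"
  obtain h where h: "bij_betw h {..<m} I"
    using ex_bij_betw_nat_finite[OF \<open>finite I\<close>] by (auto simp: m_def atLeast0LessThan)
  have reindex: "(\<Sum>i<m. g (h i)) = (\<Sum>i\<in>I. g i)" for g :: "_ \<Rightarrow> real"
    by (rule sum.reindex_bij_betw[OF h])
  have "1 \<le> m"
    using False \<open>finite I\<close> by (simp add: m_def Suc_le_eq card_gt_0_iff)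
  moreover have "w (h i) \<in> X" if "i < m" for i
    using h that w(1) by (auto simp: bij_betw_def)
  moreover have "contractive {..<m} (\<lambda>i. w (h i))"
    using w(2) reindex[of "\<lambda>i. (norm (apply_bcontfun (w i) _))\<^sup>2"] by (simp add: contractive_def)
  ultimately show ?thesis
    unfolding pi2_sub_CK[OF X] by (intro SUP_upper2[of "(m, \<lambda>i. w (h i))"]) (auto simp: reindex[of "\<lambda>i. (vnorm F (T (w i)))\<^sup>2"])
qed simp

end

text \<open>Inside the span of \<open>insert b B\<close>, the functions vanishing on T meet the span
  of B only in 0, so they form at most a line. One further point, at which a generator of the line
  is nonzero, removes it.\<close>

lemma exists_finite_separating_set:
  fixes B :: "('a::topological_space \<Rightarrow>\<^sub>C 'f::real_normed_field) set"
  assumes "finite B"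
  shows "\<exists>T. finite T \<and> (\<forall>x\<in>CK.span B. (\<forall>t\<in>T. apply_bcontfun x t = 0) \<longrightarrow> x = 0)"
  using assms
proof (induction B rule: finite_induct)
  case empty
  show ?case by auto
next
  case (insert b B)
  then obtain T where T: "finite T" "\<And>x. x \<in> CK.span B \<Longrightarrow> (\<forall>t\<in>T. apply_bcontfun x t = 0) \<Longrightarrow> x = 0"
    by auto
  show ?case
  proof (cases "\<exists>x\<in>CK.span (insert b B). (\<forall>t\<in>T. apply_bcontfun x t = 0) \<and> x \<noteq> 0")
    case False
    then show ?thesis using T by blast
  next
    case True
    then obtain x where x: "x \<in> CK.span (insert b B)" "\<And>t. t \<in> T \<Longrightarrow> apply_bcontfun x t = 0" "x \<noteq> 0"
      by auto
    then obtain t\<^sub>0 where t0: "apply_bcontfun x t\<^sub>0 \<noteq> 0"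
      by (metis bcontfun_eqI zero_bcontfun.rep_eq)
    obtain k where k: "x - scaleF k b \<in> CK.span B"
      using x(1) CK.span_breakdown_eq by blast
    have "k \<noteq> 0"
      using T(2)[of x] x k by auto
    have "y = 0" if y: "y \<in> CK.span (insert b B)" "\<forall>t\<in>insert t\<^sub>0 T. apply_bcontfun y t = 0" for y
    proof -
      obtain l where l: "y - scaleF l b \<in> CK.span B"
        using y(1) CK.span_breakdown_eq by blast
      define z where "z = y - scaleF (l / k) x"
      have "z = (y - scaleF l b) - scaleF (l / k) (x - scaleF k b)"
        using \<open>k \<noteq> 0\<close> by (simp add: z_def CK.scale_right_diff_distrib)
      then have "z \<in> CK.span B"
        using k l by (simp add: CK.span_diff CK.span_scale)
      moreover have "\<forall>t\<in>T. apply_bcontfun z t = 0"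
        using x(2) y(2) by (simp add: z_def)
      ultimately have "z = 0"
        by (rule T(2))
      then have "y = scaleF (l / k) x"
        by (simp add: z_def)
      then have "l / k = 0"
        using y(2) t0 by auto
      then show "y = 0"
        using \<open>y = scaleF (l / k) x\<close> by simp
    qed
    then show ?thesis
      using T(1) by (intro exI[of _ "insert t\<^sub>0 T"]) auto
  qed
qed

section \<open>Domination by finitely supported measures\<close>

lemma borel_measurable_prob_measures:
  fixes f :: "'a::topological_space \<Rightarrow> 'b::topological_space"
  assumes "M \<in> prob_measures" "continuous_on UNIV f"
  shows "f \<in> borel_measurable M"
proof -
  have "sets M = sets borel"
    using assms(1) by (simp add: prob_measures_def)
  then show ?thesis
    using borel_measurable_continuous_onI[OF assms(2)] by (simp cong: measurable_cong_sets)
qed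

lemma integrable_prob_measures:
  fixes f :: "'a::topological_space \<Rightarrow> 'b::{banach, second_countable_topology}"
  assumes M: "M \<in> prob_measures" and f: "continuous_on UNIV f" "\<And>t. norm (f t) \<le> C"
  shows "integrable M f"
proof -
  interpret prob_space M
    using M by (simp add: prob_measures_def)
  show ?thesis
    by (rule integrable_const_bound[of _ C]) (use f borel_measurable_prob_measures[OF M] in auto)
qed

text \<open>Regularity holds because finite sets are closed and compact in a Hausdorff space: A is
  approximated from outside by the complement of T - A and from inside by its intersection with T,
  without changing the measure.\<close>

lemma ex_prob_measure_finite_support:
  fixes c :: "'a::t2_space \<Rightarrow> real"
  assumes "finite T" "\<And>t. t \<in> T \<Longrightarrow> 0 \<le> c t" "sum c T = 1"
  shows "\<exists>M\<in>prob_measures. \<forall>f::'a \<Rightarrow> real. f \<in> borel_measurable borel \<longrightarrow>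
           (\<integral>t. f t \<partial>M) = (\<Sum>t\<in>T. c t * f t)"
proof -
  define c' where "c' t = (if t \<in> T then c t else 0)" for t
  have nonneg: "0 \<le> c' t" for t
    using assms by (simp add: c'_def)
  have "(\<integral>\<^sup>+t. ennreal (c' t) \<partial>count_space UNIV) = (\<Sum>t\<in>T. ennreal (c' t))"
    using assms(1) by (intro nn_integral_count_space') (auto simp: c'_def)
  also have "\<dots> = ennreal (sum c' T)"
    using nonneg by (intro sum_ennreal) auto
  also have "\<dots> = 1"
    using assms(3) by (simp add: c'_def cong: sum.cong)
  finally have total: "(\<integral>\<^sup>+t. ennreal (c' t) \<partial>count_space UNIV) = 1" .
  define p where "p = embed_pmf c'"
  have pmf: "pmf p t = c' t" for t
    unfolding p_def by (rule pmf_embed_pmf[OF nonneg total])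
  have supp: "set_pmf p \<subseteq> T"
    using pmf by (auto simp: set_pmf_iff c'_def split: if_splits)
  \<comment> \<open>For \<open>measure_pmf\<close> every set is measurable; the image under the
    identity restricts the measure to the Borel sets.\<close>
  define M where "M = distr (measure_pmf p) borel (\<lambda>t. t)"
  have sets_M: "sets M = sets borel"
    by (simp add: M_def)
  have emeasure_M: "emeasure M A = emeasure (measure_pmf p) A" if "A \<in> sets borel" for A
    using that by (simp add: M_def emeasure_distr)
  have cut: "emeasure (measure_pmf p) A = emeasure (measure_pmf p) B" if "A \<inter> T = B \<inter> T" for A B
  proof -
    have "A \<inter> set_pmf p = B \<inter> set_pmf p"
      using that supp by blast
    then show ?thesis
      by (metis emeasure_Int_set_pmf)
  qed
  have "M \<in> prob_measures"
    unfolding prob_measures_def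
  proof (safe intro!: sets_M[THEN equalityD1, THEN subsetD] sets_M[THEN equalityD2, THEN subsetD])
    show "prob_space M"
      unfolding M_def by (rule prob_space.prob_space_distr) (auto intro: measure_pmf.prob_space_axioms)
    fix A :: "'a set" assume A: "A \<in> sets borel"
    have fin: "finite (T - A)" "finite (A \<inter> T)"
      using assms(1) by auto
    show "emeasure M A = (INF U\<in>{U. open U \<and> A \<subseteq> U}. emeasure M U)"
    proof (rule antisym)
      show "emeasure M A \<le> (INF U\<in>{U. open U \<and> A \<subseteq> U}. emeasure M U)"
        by (rule INF_greatest) (auto intro!: emeasure_mono simp: sets_M)
      have op: "open (- (T - A))"
        by (intro open_Compl finite_imp_closed fin)
      have "emeasure M (- (T - A)) = emeasure M A"
        using op A cut[of "- (T - A)" A] by (simp add: emeasure_M Int_commute) blast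
      then show "(INF U\<in>{U. open U \<and> A \<subseteq> U}. emeasure M U) \<le> emeasure M A"
        using op by (intro INF_lower2[of "- (T - A)"]) auto
    qed
    show "emeasure M A = (SUP C\<in>{C. compact C \<and> C \<subseteq> A}. emeasure M C)"
    proof (rule antisym)
      show "(SUP C\<in>{C. compact C \<and> C \<subseteq> A}. emeasure M C) \<le> emeasure M A"
        using A by (intro SUP_least emeasure_mono) (auto simp: sets_M)
      have "emeasure M (A \<inter> T) = emeasure M A"
        using A cut[of "A \<inter> T" A] finite_imp_closed[OF fin(2)] by (simp add: emeasure_M)
      then show "emeasure M A \<le> (SUP C\<in>{C. compact C \<and> C \<subseteq> A}. emeasure M C)"
        using finite_imp_compact[OF fin(2)] by (intro SUP_upper2[of "A \<inter> T"]) auto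
    qed
  qed
  moreover have "(\<integral>t. f t \<partial>M) = (\<Sum>t\<in>T. c t * f t)" if "f \<in> borel_measurable borel" for f :: "'a \<Rightarrow> real"
  proof -
    have "(\<integral>t. f t \<partial>M) = (\<integral>t. f t \<partial>measure_pmf p)"
      using that unfolding M_def by (intro integral_distr) auto
    also have "\<dots> = (\<Sum>t\<in>T. pmf p t *\<^sub>R f t)"
      using supp by (intro integral_measure_pmf[OF assms(1)]) auto
    finally show ?thesis
      by (simp add: pmf c'_def)
  qed
  ultimately show ?thesis
    by blast
qed

section \<open>Finitely supported functions as a normed space of matrices of variable size\<close>

lemma norm_single: "norm (Poly_Mapping.single i a) = norm (a :: 'b::real_normed_vector)"
  by (simp add: norm_poly_mapping_def dist_poly_mapping_def)

lemma lookup_scaleR: "Poly_Mapping.lookup (r *\<^sub>R p) i = r *\<^sub>R Poly_Mapping.lookup p i"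
proof -
  have "finite {i. r *\<^sub>R Poly_Mapping.lookup p i \<noteq> 0}"
    by (rule finite_subset[OF _ finite_lookup[of p]]) auto
  then show ?thesis
    by (simp add: scaleR_poly_mapping_def Abs_poly_mapping_inverse)
qed

lemma bounded_linear_single:
  "bounded_linear (Poly_Mapping.single i :: 'b::real_normed_vector \<Rightarrow> _)"
  by (rule bounded_linear_intro[where K = 1])
    (auto simp: single_add norm_single lookup_scaleR lookup_single when_def intro!: poly_mapping_eqI)

lemma bounded_linear_lookup:
  "bounded_linear (\<lambda>p :: 'i \<Rightarrow>\<^sub>0 'b::real_normed_vector. Poly_Mapping.lookup p i)"
proof (rule bounded_linear_intro[where K = 1])
  fix p :: "'i \<Rightarrow>\<^sub>0 'b"
  show "norm (Poly_Mapping.lookup p i) \<le> norm p * 1"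
  proof (cases "i \<in> Poly_Mapping.keys p")
    case True
    then have "norm (Poly_Mapping.lookup p i) \<le> (\<Sum>n\<in>Poly_Mapping.keys p. norm (Poly_Mapping.lookup p n))"
      by (intro member_le_sum) auto
    then show ?thesis
      by (simp add: norm_poly_mapping_def dist_poly_mapping_def)
  qed (simp add: in_keys_iff)
qed (auto simp: lookup_add lookup_scaleR)

context conjugation
begin

text \<open>
  The map \<open>\<Phi>\<close> sends \<open>t\<close> to the matrix \<open>(b(t) cj(b'(t)))\<close>, \<open>b, b' \<in> B\<close>, on which \<open>|x(t)|\<^sup>2\<close> depends
  linearly. As \<open>X\<close> is finite-dimensional the convex hull of \<open>\<Phi>(K)\<close> is compact, so finitely
  supported measures suffice and no representation theorem for functionals on \<open>C(K)\<close> is needed.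
\<close>

lemma pietsch_domination:
  fixes B :: "('a::t2_space \<Rightarrow>\<^sub>C 'f) set" and q :: "('a \<Rightarrow>\<^sub>C 'f) \<Rightarrow> real"
  assumes K: "compact (UNIV :: 'a set)" and B: "finite B"
    and quad: "\<And>x c. x \<in> CK.span B \<Longrightarrow> q (scaleF c x) = (norm c)\<^sup>2 * q x"
    and bound: "\<And>I w. finite I \<Longrightarrow> I \<subseteq> CK.span B \<Longrightarrow> (\<And>i. i \<in> I \<Longrightarrow> w i \<in> CK.span B) \<Longrightarrow>
        contractive I w \<Longrightarrow> (\<Sum>i\<in>I. q (w i)) \<le> C"
  shows "\<exists>M\<in>prob_measures. \<forall>x\<in>CK.span B. q x \<le> C * (\<integral>t. (norm (apply_bcontfun x t))\<^sup>2 \<partial>M)"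
proof -
  define \<Phi> where "\<Phi> t = (\<Sum>r\<in>B \<times> B. Poly_Mapping.single r (apply_bcontfun (fst r) t * cj (apply_bcontfun (snd r) t)))"
    for t
  have lookup_\<Phi>: "Poly_Mapping.lookup (\<Phi> t) r = apply_bcontfun (fst r) t * cj (apply_bcontfun (snd r) t)"
    if "r \<in> B \<times> B" for r t
    using that B by (simp add: \<Phi>_def lookup_sum lookup_single when_def)
  have cont_\<Phi>: "continuous_on UNIV \<Phi>"
    unfolding \<Phi>_def
    by (intro continuous_intros bounded_linear.continuous_on[OF bounded_linear_single]) auto
  \<comment> \<open>A finite real spanning set for the matrices, which gives access to the
    compactness of the convex hull in an infinite-dimensional type.\<close>
  define D where "D = (\<lambda>(r, b). Poly_Mapping.single r (b :: 'f)) ` ((B \<times> B) \<times> Basis)"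
  have D: "finite D"
    using B by (simp add: D_def)
  have range_\<Phi>: "range \<Phi> \<subseteq> span D"
  proof clarify
    fix t
    have "Poly_Mapping.single r a \<in> span D" if "r \<in> B \<times> B" for r and a :: 'f
    proof -
      interpret L: bounded_linear "Poly_Mapping.single r :: 'f \<Rightarrow> _"
        by (rule bounded_linear_single)
      have "Poly_Mapping.single r a = (\<Sum>b\<in>Basis. inner a b *\<^sub>R Poly_Mapping.single r b)"
        by (subst euclidean_representation[of a, symmetric]) (simp only: L.sum L.scaleR)
      also have "\<dots> \<in> span D"
        using that by (intro span_sum span_scale span_base) (auto simp: D_def intro!: image_eqI[of _ _ "(_, _)"])
      finally show ?thesis .
    qed
    then show "\<Phi> t \<in> span D"
      unfolding \<Phi>_def by (intro span_sum) auto
  qed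
  have "\<exists>k. x = (\<Sum>b\<in>B. scaleF (k b) b)" if "x \<in> CK.span B" for x
    using that CK.span_finite[OF B] by auto
  then obtain k where k: "\<And>x. x \<in> CK.span B \<Longrightarrow> x = (\<Sum>b\<in>B. scaleF (k x b) b)"
    by metis
  \<comment> \<open>With k the chosen coordinates of x, this real linear functional takes the value
    |x(t)|^2 at \<Phi>(t). At a convex combination of such matrices it is therefore the integral of
    |x|^2 for the corresponding discrete measure.\<close>
  define L where "L x p = inner (\<Sum>r\<in>B \<times> B. k x (fst r) * cj (k x (snd r)) * Poly_Mapping.lookup p r) 1" for x p
  have L: "bounded_linear (L x)" for x
    unfolding L_def
    by (intro bounded_linear_inner_left_comp bounded_linear_sum bounded_linear_const_mult bounded_linear_lookup)
  have L_\<Phi>: "L x (\<Phi> t) = (norm (apply_bcontfun x t))\<^sup>2" if x: "x \<in> CK.span B" for x t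
  proof -
    have xt: "apply_bcontfun x t = (\<Sum>b\<in>B. k x b * apply_bcontfun b t)"
      by (subst k[OF x]) (simp add: apply_bcontfun_sum)
    have "(\<Sum>r\<in>B \<times> B. k x (fst r) * cj (k x (snd r)) * Poly_Mapping.lookup (\<Phi> t) r) =
        (\<Sum>r\<in>B \<times> B. (k x (fst r) * apply_bcontfun (fst r) t) * cj (k x (snd r) * apply_bcontfun (snd r) t))"
      by (intro sum.cong) (auto simp: lookup_\<Phi> cj_mult)
    also have "\<dots> = apply_bcontfun x t * cj (apply_bcontfun x t)"
      unfolding xt cj_sum sum_product by (simp add: sum.cartesian_product case_prod_beta)
    finally show ?thesis
      unfolding L_def by (simp only: mult_cj inner_of_real_1)
  qed
  have "\<exists>p\<in>convex hull range \<Phi>. \<forall>x\<in>CK.span B. 0 \<le> C * L x p - q x"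
  proof (rule affine_inequalities_feasible)
    show "compact (convex hull range \<Phi>)"
      using compact_convex_hull_span[OF compact_continuous_image[OF cont_\<Phi> K] D range_\<Phi>] .
    show "continuous_on (convex hull range \<Phi>) (\<lambda>p. C * L x p - q x)" for x
      by (intro continuous_intros bounded_linear.continuous_on[OF L])
    show "C * L x ((1 - r) *\<^sub>R p + r *\<^sub>R p') - q x = (1 - r) * (C * L x p - q x) + r * (C * L x p' - q x)" for x r p p'
    proof -
      interpret bounded_linear "L x" by (rule L)
      show ?thesis unfolding add scaleR by (simp add: algebra_simps)
    qed
    fix J d assume J: "finite J" "J \<subseteq> CK.span B" and d: "\<And>x. x \<in> J \<Longrightarrow> 0 \<le> (d x :: real)"
    \<comment> \<open>A single combined inequality is solved by a point mass, placed at a maximum of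
      G.\<close>
    define G where "G t = (\<Sum>x\<in>J. d x * (norm (apply_bcontfun x t))\<^sup>2)" for t
    have "continuous_on UNIV G"
      unfolding G_def by (intro continuous_intros) auto
    then obtain t\<^sub>0 where t0: "\<And>t. G t \<le> G t\<^sub>0"
      using continuous_attains_sup[OF K, of G] by auto
    have G0: "0 \<le> G t" for t
      using d by (simp add: G_def sum_nonneg)
    have "(\<Sum>x\<in>J. d x * q x) \<le> C * G t\<^sub>0"
    proof (cases "G t\<^sub>0 = 0")
      case True
      then have "G t = 0" for t
        using t0[of t] G0[of t] by simp
      then have vanish: "\<forall>x\<in>J. d x * (norm (apply_bcontfun x t))\<^sup>2 = 0" for t
        unfolding G_def using J(1) d by (subst (asm) sum_nonneg_eq_0_iff) auto
      have zero: "d x = 0 \<or> x = 0" if "x \<in> J" for x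
      proof (rule disjCI)
        assume "x \<noteq> 0"
        then obtain t where "apply_bcontfun x t \<noteq> 0"
          by (metis bcontfun_eqI zero_bcontfun.rep_eq)
        then show "d x = 0"
          using vanish[of t] that by auto
      qed
      have "q 0 = 0"
        using quad[of 0 0] CK.span_zero[of B] by simp
      then have "d x * q x = 0" if "x \<in> J" for x
        using zero[OF that] by auto
      then have "(\<Sum>x\<in>J. d x * q x) = 0"
        by (intro sum.neutral) auto
      then show ?thesis
        using True by simp
    next
      case False
      then have pos: "0 < G t\<^sub>0"
        using G0[of t\<^sub>0] by simp
      \<comment> \<open>Dividing by the maximum of G makes the weighted family contractive, so
        \<open>bound\<close> applies to it.\<close>
      define w where "w x = scaleF (of_real (sqrt (d x / G t\<^sub>0))) x" for x :: "'a \<Rightarrow>\<^sub>C 'f"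
      have coeff: "(norm (of_real (sqrt (d x / G t\<^sub>0)) :: 'f))\<^sup>2 = d x / G t\<^sub>0" if "x \<in> J" for x
        using d[OF that] pos by simp
      have "contractive J w"
        unfolding contractive_def
      proof
        fix t
        have "(\<Sum>x\<in>J. (norm (apply_bcontfun (w x) t))\<^sup>2) = G t / G t\<^sub>0"
          unfolding G_def[of t] sum_divide_distrib w_def
          by (intro sum.cong) (simp_all only: apply_scaleF norm_mult power_mult_distrib coeff times_divide_eq_left)
        then show "(\<Sum>x\<in>J. (norm (apply_bcontfun (w x) t))\<^sup>2) \<le> 1"
          using t0[of t] pos by simp
      qed
      moreover have "w x \<in> CK.span B" if "x \<in> J" for x
        using that J by (auto simp: w_def intro: CK.span_scale)
      ultimately have "(\<Sum>x\<in>J. q (w x)) \<le> C"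
        using J by (intro bound) auto
      moreover have "(\<Sum>x\<in>J. q (w x)) = (\<Sum>x\<in>J. d x * q x) / G t\<^sub>0"
        unfolding sum_divide_distrib
      proof (intro sum.cong refl)
        fix x assume "x \<in> J"
        then show "q (w x) = d x * q x / G t\<^sub>0"
          using J by (simp only: w_def quad subset_iff coeff times_divide_eq_left)
      qed
      ultimately show ?thesis
        using pos by (simp add: pos_divide_le_eq)
    qed
    also have "C * G t\<^sub>0 = (\<Sum>x\<in>J. d x * (C * L x (\<Phi> t\<^sub>0)))"
      unfolding G_def sum_distrib_left using J(2) by (intro sum.cong) (auto simp: L_\<Phi>)
    finally have "0 \<le> (\<Sum>x\<in>J. d x * (C * L x (\<Phi> t\<^sub>0) - q x))"
      by (simp add: right_diff_distrib sum_subtractf)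
    then show "\<exists>p\<in>convex hull range \<Phi>. 0 \<le> (\<Sum>x\<in>J. d x * (C * L x p - q x))"
      by (intro bexI[of _ "\<Phi> t\<^sub>0"] hull_inc) auto
  qed auto
  then obtain p where p: "p \<in> convex hull range \<Phi>" "\<And>x. x \<in> CK.span B \<Longrightarrow> q x \<le> C * L x p"
    by auto
  then obtain S u where S: "finite S" "S \<subseteq> range \<Phi>" "\<forall>v\<in>S. 0 \<le> u v" "sum u S = 1" "(\<Sum>v\<in>S. u v *\<^sub>R v) = p"
    unfolding convex_hull_explicit by auto
  \<comment> \<open>One point is selected for each matrix in S, so that no weight is counted twice
    when \<Phi> is not injective.\<close>
  obtain T where T: "inj_on \<Phi> T" "S = \<Phi> ` T"
    using S(2) by (auto simp: subset_image_inj)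
  have finT: "finite T"
    using T S(1) finite_image_iff by blast
  define c where "c t = u (\<Phi> t)" for t
  have c: "\<And>t. t \<in> T \<Longrightarrow> 0 \<le> c t" "sum c T = 1"
    using S T by (auto simp: c_def sum.reindex)
  obtain M where M: "M \<in> prob_measures"
    "\<And>f :: 'a \<Rightarrow> real. f \<in> borel_measurable borel \<Longrightarrow> (\<integral>t. f t \<partial>M) = (\<Sum>t\<in>T. c t * f t)"
    using ex_prob_measure_finite_support[OF finT c] by blast
  have "L x p = (\<integral>t. (norm (apply_bcontfun x t))\<^sup>2 \<partial>M)" if x: "x \<in> CK.span B" for x
  proof -
    interpret bounded_linear "L x" by (rule L)
    have "p = (\<Sum>t\<in>T. c t *\<^sub>R \<Phi> t)"
      using S(5) T by (simp add: c_def sum.reindex)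
    then have "L x p = (\<Sum>t\<in>T. c t * (norm (apply_bcontfun x t))\<^sup>2)"
      using x by (simp add: sum scaleR L_\<Phi>)
    also have "\<dots> = (\<integral>t. (norm (apply_bcontfun x t))\<^sup>2 \<partial>M)"
      by (rule M(2)[symmetric], intro borel_measurable_continuous_onI continuous_intros) auto
    finally show ?thesis .
  qed
  then show ?thesis
    using M(1) p(2) by (intro bexI[of _ M]) auto
qed

end

section \<open>The L_2 form on continuous functions and its quotient X_2\<close>

lemma L2_class_cong:
  assumes "AE t in M. f t = g t"
  shows "L2_class M f = L2_class M g"
  unfolding L2_class_def using assms by (auto elim: eventually_elim2)

context conjugation
begin

text \<open>The pullback of the l_2 inner product under finitely many functionals. It is used for
  point evaluations and for the coordinates of an operator into l_2^k.\<close>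

lemma semi_inner_sum_functionals:
  fixes X :: "('a::topological_space \<Rightarrow>\<^sub>C 'f) set"
  assumes "CK.subspace X"
    and "\<And>i x y. i \<in> I \<Longrightarrow> x \<in> X \<Longrightarrow> y \<in> X \<Longrightarrow> f i (x + y) = f i x + f i y"
    and "\<And>i x c. i \<in> I \<Longrightarrow> x \<in> X \<Longrightarrow> f i (scaleF c x) = c * f i x"
  shows "semi_inner cj X (\<lambda>x y. \<Sum>i\<in>I. f i x * cj (f i y))"
proof unfold_locales
  fix x assume "x \<in> X"
  have "(\<Sum>i\<in>I. f i x * cj (f i x)) = of_real (\<Sum>i\<in>I. (norm (f i x))\<^sup>2)"
    by (simp add: mult_cj)
  then show "(\<Sum>i\<in>I. f i x * cj (f i x)) = of_real (norm (\<Sum>i\<in>I. f i x * cj (f i x)))"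
    by (simp add: sum_nonneg del: of_real_sum)
qed (use assms in \<open>auto simp: sum.distrib sum_distrib_left cj_sum cj_mult algebra_simps
      cong: sum.cong\<close>)

lemma norm_sum_mult_cj: "norm (\<Sum>i\<in>I. f i * cj (f i)) = (\<Sum>i\<in>I. (norm (f i))\<^sup>2)"
proof -
  have "(\<Sum>i\<in>I. f i * cj (f i)) = of_real (\<Sum>i\<in>I. (norm (f i))\<^sup>2)"
    by (simp add: mult_cj)
  then show ?thesis
    by (simp add: sum_nonneg del: of_real_sum)
qed

definition L2_inner :: "'a::topological_space measure \<Rightarrow> ('a \<Rightarrow>\<^sub>C 'f) \<Rightarrow> ('a \<Rightarrow>\<^sub>C 'f) \<Rightarrow> 'f" where
  "L2_inner M x y = (\<integral>t. apply_bcontfun x t * cj (apply_bcontfun y t) \<partial>M)"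

context
  fixes M :: "'a::topological_space measure"
  assumes M: "M \<in> prob_measures"
begin

lemma integrable_L2_inner:
  "integrable M (\<lambda>t. apply_bcontfun x t * cj (apply_bcontfun y t))" for x y :: "'a \<Rightarrow>\<^sub>C 'f"
proof (rule integrable_prob_measures[OF M])
  show "norm (apply_bcontfun x t * cj (apply_bcontfun y t)) \<le> norm x * norm y" for t
    by (auto simp: norm_mult norm_bounded intro!: mult_mono)
qed (auto intro!: continuous_intros)

lemma integrable_norm_sq:
  "integrable M (\<lambda>t. (norm (apply_bcontfun x t))\<^sup>2)" for x :: "'a \<Rightarrow>\<^sub>C 'f"
  by (rule integrable_prob_measures[OF M, where C = "(norm x)\<^sup>2"])
    (auto intro!: continuous_intros power_mono norm_bounded)

lemma L2_inner_self:
  "L2_inner M x x = of_real (\<integral>t. (norm (apply_bcontfun x t))\<^sup>2 \<partial>M)"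
  unfolding L2_inner_def mult_cj
  by (rule integral_bounded_linear[OF bounded_linear_of_real integrable_norm_sq])

lemma norm_L2_inner_self:
  "norm (L2_inner M x x) = (\<integral>t. (norm (apply_bcontfun x t))\<^sup>2 \<partial>M)"
  by (simp add: L2_inner_self)

lemma semi_inner_L2_inner:
  assumes "CK.subspace X"
  shows "semi_inner cj X (L2_inner M)"
proof unfold_locales
  fix x y :: "'a \<Rightarrow>\<^sub>C 'f" and c
  show "L2_inner M (x + y) z = L2_inner M x z + L2_inner M y z" for z
    unfolding L2_inner_def by (simp add: distrib_right integrable_L2_inner)
  show "L2_inner M (scaleF c x) y = c * L2_inner M x y"
    unfolding L2_inner_def by (simp add: mult.assoc)
  show "L2_inner M y x = cj (L2_inner M x y)"
    unfolding L2_inner_def integral_bounded_linear[OF bounded_linear_cj integrable_L2_inner, symmetric]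
    by (simp add: cj_mult mult.commute)
  show "L2_inner M x x = of_real (norm (L2_inner M x x))"
    by (simp add: L2_inner_self)
qed (rule assms)

lemma sq_integrable_apply: "sq_integrable M (apply_bcontfun x)" for x :: "'a \<Rightarrow>\<^sub>C 'f"
  unfolding sq_integrable_def using integrable_norm_sq borel_measurable_prob_measures[OF M] by auto

lemma L2_rep_I2:
  fixes x :: "'a \<Rightarrow>\<^sub>C 'f"
  shows "L2_rep (I2 M x) \<in> borel_measurable M" "AE t in M. L2_rep (I2 M x) t = apply_bcontfun x t"
proof -
  have "apply_bcontfun x \<in> I2 M x"
    by (simp add: I2_def L2_class_def sq_integrable_apply)
  then have "L2_rep (I2 M x) \<in> I2 M x"
    unfolding L2_rep_def by (rule someI[of "\<lambda>f. f \<in> I2 M x"])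
  then show "L2_rep (I2 M x) \<in> borel_measurable M" "AE t in M. L2_rep (I2 M x) t = apply_bcontfun x t"
    by (auto simp: I2_def L2_class_def sq_integrable_def)
qed

lemma vadd_I2: "vadd (X2 M X) (I2 M x) (I2 M y) = I2 M (x + y)" for x y :: "'a \<Rightarrow>\<^sub>C 'f"
  unfolding X2_def L2_def I2_def[of M "x + y"]
  using L2_rep_I2(2)[of x] L2_rep_I2(2)[of y] by (auto intro!: L2_class_cong)

lemma vscale_I2: "vscale (X2 M X) c (I2 M x) = I2 M (scaleF c x)" for x :: "'a \<Rightarrow>\<^sub>C 'f"
  unfolding X2_def L2_def I2_def[of M "scaleF c x"]
  using L2_rep_I2(2)[of x] by (auto intro!: L2_class_cong)

lemma vnorm_I2: "vnorm (X2 M X) (I2 M x) = sqrt (norm (L2_inner M x x))" for x :: "'a \<Rightarrow>\<^sub>C 'f"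
proof -
  have "(\<integral>t. (norm (L2_rep (I2 M x) t))\<^sup>2 \<partial>M) = (\<integral>t. (norm (apply_bcontfun x t))\<^sup>2 \<partial>M)"
    using L2_rep_I2[of x] borel_measurable_integrable[OF integrable_norm_sq[of x]]
    by (intro integral_cong_AE) auto
  then show ?thesis
    by (simp add: X2_def L2_def norm_L2_inner_self)
qed

text \<open>The identifications made in X_2 are exactly those by null vectors; this justifies
  working with the degenerate form on X.\<close>

lemma I2_eq_iff: "I2 M x = I2 M y \<longleftrightarrow> L2_inner M (x - y) (x - y) = 0" for x y :: "'a \<Rightarrow>\<^sub>C 'f"
proof -
  have "L2_inner M (x - y) (x - y) = 0 \<longleftrightarrow> (AE t in M. apply_bcontfun x t = apply_bcontfun y t)"
    using integral_nonneg_eq_0_iff_AE[OF integrable_norm_sq[of "x - y"]] by (simp add: L2_inner_self)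
  also have "\<dots> \<longleftrightarrow> I2 M x = I2 M y"
  proof
    assume "AE t in M. apply_bcontfun x t = apply_bcontfun y t"
    then show "I2 M x = I2 M y"
      unfolding I2_def by (rule L2_class_cong)
  next
    assume eq: "I2 M x = I2 M y"
    show "AE t in M. apply_bcontfun x t = apply_bcontfun y t"
      using L2_rep_I2(2)[of x] L2_rep_I2(2)[of y] unfolding eq by eventually_elim simp
  qed
  finally show ?thesis ..
qed

lemma subspace_in_X2:
  fixes X :: "('a \<Rightarrow>\<^sub>C 'f) set"
  assumes "CK.subspace W" "W \<subseteq> X"
  shows "subspace_in (X2 M X) (I2 M ` W)"
  unfolding subspace_in_def
  using assms CK.subspace_0[OF assms(1)] CK.subspace_add[OF assms(1)] CK.subspace_scale[OF assms(1)]
  by (auto simp: vadd_I2 vscale_I2 X2_def[of M X, THEN arg_cong[of _ _ vecs]])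

lemma span_in_X2:
  fixes X :: "('a \<Rightarrow>\<^sub>C 'f) set"
  assumes X: "CK.subspace X" and B: "B \<subseteq> X"
  shows "span_in (X2 M X) (I2 M ` B) = I2 M ` CK.span B"
proof
  have "subspace_in (X2 M X) (I2 M ` CK.span B)"
    using CK.span_minimal[OF B X] by (intro subspace_in_X2) auto
  then show "span_in (X2 M X) (I2 M ` B) \<subseteq> I2 M ` CK.span B"
    unfolding span_in_def using CK.span_superset[of B] by blast
  show "I2 M ` CK.span B \<subseteq> span_in (X2 M X) (I2 M ` B)"
    unfolding span_in_def
  proof (rule Inter_greatest)
    fix V assume "V \<in> {V. subspace_in (X2 M X) V \<and> I2 M ` B \<subseteq> V}"
    then have V: "V \<noteq> {}" "V \<subseteq> I2 M ` X" "\<And>a b. a \<in> V \<Longrightarrow> b \<in> V \<Longrightarrow> vadd (X2 M X) a b \<in> V"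
      "\<And>c a. a \<in> V \<Longrightarrow> vscale (X2 M X) c a \<in> V" "I2 M ` B \<subseteq> V"
      by (auto simp: subspace_in_def X2_def)
    have "CK.subspace {x. I2 M x \<in> V}"
    proof (rule CK.subspaceI)
      obtain x where "I2 M x \<in> V"
        using V(1,2) by auto
      \<comment> \<open>\<open>subspace_in\<close> asks only for nonemptiness, so 0 is obtained by
        scaling some element with 0.\<close>
      then have "I2 M (scaleF 0 x) \<in> V"
        by (metis V(4) vscale_I2)
      then show "0 \<in> {x. I2 M x \<in> V}"
        by simp
    qed (use V(3,4) in \<open>auto simp flip: vadd_I2[of X] vscale_I2[of X]\<close>)
    then have "CK.span B \<subseteq> {x. I2 M x \<in> V}"
      using V(5) by (intro CK.span_minimal) auto
    then show "I2 M ` CK.span B \<subseteq> V"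
      by auto
  qed
qed

lemma ex_operator_with_same_norms:
  fixes X :: "('a \<Rightarrow>\<^sub>C 'f) set"
  assumes X: "CK.subspace X" and P: "linear_op (X2 M X) (X2 M X) P" and rank: "rank_le (X2 M X) (X2 M X) P k"
  shows "\<exists>u. linear_op (sub_CK X) (ell2 k) u \<and>
           (\<forall>x\<in>X. vnorm (ell2 k) (u x) = vnorm (X2 M X) (P (I2 M x)))"
proof -
  interpret S: semi_inner cj X "L2_inner M"
    by (rule semi_inner_L2_inner[OF X])
  have vecs: "vecs (X2 M X) = I2 M ` X"
    by (simp add: X2_def)
  obtain B where B: "B \<subseteq> I2 M ` X" "finite B" "card B \<le> k" "span_in (X2 M X) B = P ` I2 M ` X"
    using rank by (auto simp: rank_le_def has_dim_def vecs)
  \<comment> \<open>Lifting the classes injectively to functions keeps the cardinality at most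
    k.\<close>
  obtain B' where B': "B' \<subseteq> X" "B = I2 M ` B'" "finite B'" "card B' \<le> k"
    using B(1-3) subset_image_inj[of B "I2 M" X] by (metis card_image finite_image_iff)
  have range: "P ` I2 M ` X = I2 M ` CK.span B'"
    using span_in_X2[OF X B'(1)] B(4) B'(2) by simp
  then have "\<exists>y\<in>CK.span B'. P (I2 M x) = I2 M y" if "x \<in> X" for x
    using that by (metis imageE imageI)
  \<comment> \<open>The chosen y need not be linear. Only its coefficients against the orthonormal
    system enter below; by \<open>same\<close> they depend on the class alone, and on classes P is
    linear.\<close>
  then obtain y where y: "\<And>x. x \<in> X \<Longrightarrow> y x \<in> CK.span B'" "\<And>x. x \<in> X \<Longrightarrow> P (I2 M x) = I2 M (y x)"
    by metis
  have yX: "x \<in> X \<Longrightarrow> y x \<in> X" for x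
    using y(1) CK.span_minimal[OF B'(1) X] by auto
  obtain d e where e: "d \<le> card B'" "S.orthonormal d e" "\<And>x. x \<in> CK.span B' \<Longrightarrow> S.sq (x - S.proj d e x) = 0"
    using S.gram_schmidt[OF B'(3,1)] by blast
  have dk: "d \<le> k"
    using e(1) B'(4) by simp
  have eX: "i < d \<Longrightarrow> e i \<in> X" for i
    using e(2) by (simp add: S.orthonormal_def)
  \<comment> \<open>Padded with zeros, since d may be smaller than k.\<close>
  define u where "u x i = (if i < d then L2_inner M (y x) (e i) else 0)" for x i
  have same: "L2_inner M a (e i) = L2_inner M b (e i)" if "I2 M a = I2 M b" "a \<in> X" "b \<in> X" "i < d" for a b i
  proof -
    have "S.sq (a - b) = 0"
      using that(1) by (simp add: S.sq_def I2_eq_iff)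
    then have "L2_inner M (a - b) (e i) = 0"
      using that eX by (intro S.null_left) auto
    then show ?thesis
      using that eX by (simp add: S.diff_left)
  qed
  have "linear_op (sub_CK X) (ell2 k) u"
    unfolding linear_op_def
  proof (intro conjI ballI allI)
    show "u x \<in> vecs (ell2 k)" for x
      using dk by (auto simp: u_def ell2_def)
  next
    fix x z assume "x \<in> vecs (sub_CK X)" "z \<in> vecs (sub_CK X)"
    then have xz: "x \<in> X" "z \<in> X"
      by (simp_all add: sub_CK_def)
    have "I2 M (y (x + z)) = P (vadd (X2 M X) (I2 M x) (I2 M z))"
      using xz y(2)[of "x + z"] by (simp add: vadd_I2)
    also have "\<dots> = I2 M (y x + y z)"
      using P xz by (simp add: linear_op_def vecs y(2) vadd_I2)
    finally have "L2_inner M (y (x + z)) (e i) = L2_inner M (y x) (e i) + L2_inner M (y z) (e i)" if "i < d" for i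
      using that xz same[of "y (x + z)" "y x + y z" i] yX eX by (simp add: S.add_left)
    then show "u (vadd (sub_CK X) x z) = vadd (ell2 k) (u x) (u z)"
      by (auto simp: u_def ell2_def sub_CK_def)
  next
    fix c x assume "x \<in> vecs (sub_CK X)"
    then have x: "x \<in> X"
      by (simp add: sub_CK_def)
    have "I2 M (y (scaleF c x)) = P (vscale (X2 M X) c (I2 M x))"
      using x y(2)[of "scaleF c x"] by (simp add: vscale_I2)
    also have "\<dots> = I2 M (scaleF c (y x))"
      using P x by (simp add: linear_op_def vecs y(2) vscale_I2)
    finally have "L2_inner M (y (scaleF c x)) (e i) = c * L2_inner M (y x) (e i)" if "i < d" for i
      using that x same[of "y (scaleF c x)" "scaleF c (y x)" i] yX eX by (simp add: S.scale_left)
    then show "u (vscale (sub_CK X) c x) = vscale (ell2 k) c (u x)"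
      by (auto simp: u_def ell2_def sub_CK_def)
  qed
  moreover have "vnorm (ell2 k) (u x) = vnorm (X2 M X) (P (I2 M x))" if x: "x \<in> X" for x
  proof -
    have "(\<Sum>i<k. (norm (u x i))\<^sup>2) = (\<Sum>i<d. (norm (L2_inner M (y x) (e i)))\<^sup>2)"
      unfolding u_def using dk by (intro sum.mono_neutral_cong_right) auto
    also have "\<dots> = S.sq (S.proj d e (y x))"
      by (rule S.sq_proj[OF e(2), symmetric])
    also have "\<dots> = S.sq (y x)"
      using S.pythagoras[OF e(2) yX[OF x]] e(3)[OF y(1)[OF x]] by simp
    finally show ?thesis
      using x by (simp add: ell2_def L2_set_def y(2) vnorm_I2 S.sq_def)
  qed
  ultimately show ?thesis
    by blast
qed

end

lemma pi2_opnorm_cong: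
  fixes X :: "('a::topological_space \<Rightarrow>\<^sub>C 'f) set"
  assumes X: "CK.subspace X" and eq: "\<And>x. x \<in> X \<Longrightarrow> vnorm F (T x) = vnorm G (S x)"
  shows "pi2 (sub_CK X) F T = pi2 (sub_CK X) G S" "opnorm (sub_CK X) F T = opnorm (sub_CK X) G S"
  unfolding pi2_sub_CK[OF X] opnorm_def
  by (auto intro!: SUP_cong sum.cong arg_cong[of _ _ sqrt] arg_cong[of _ _ ennreal] simp: eq sub_CK_def)

end

section \<open>Projections on \<open>X\<^sub>2\<close>\<close>

lemma ennreal_inverse_antimono:
  fixes a b :: ennreal
  assumes "b \<le> a"
  shows "inverse a \<le> inverse b"
proof (cases "b = 0 \<or> a = top")
  case False
  then obtain r q where "a = ennreal r" "b = ennreal q" "0 \<le> r" "0 < q"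
    using assms by (cases a; cases b) (auto simp: top_unique order_le_less)
  then show ?thesis
    using assms by (simp add: inverse_ennreal le_imp_inverse_le)
qed auto

context conjugation
begin

context
  fixes M :: "'a::topological_space measure" and X :: "('a \<Rightarrow>\<^sub>C 'f) set"
  assumes M: "M \<in> prob_measures" and X: "CK.subspace X"
begin

interpretation S: semi_inner cj X "L2_inner M"
  by (rule semi_inner_L2_inner[OF M X])

lemma vecs_X2: "vecs (X2 M X) = I2 M ` X"
  by (simp add: X2_def)

lemma vnorm_I2_sq: "vnorm (X2 M X) (I2 M x) = sqrt (S.sq x)"
  by (simp add: vnorm_I2[OF M] S.sq_def)

lemma I2_eq_iff_sq: "I2 M x = I2 M y \<longleftrightarrow> S.sq (x - y) = 0"
  by (simp add: I2_eq_iff[OF M] S.sq_def)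

text \<open>Taking the coefficient at e_j is well defined on classes, and it separates the class of
  e_j from the span of the other classes.\<close>

lemma has_dim_I2_span_orthonormal:
  assumes e: "S.orthonormal d e"
  shows "has_dim (X2 M X) (I2 M ` CK.span (e ` {..<d})) d"
proof -
  have eX: "e i \<in> X" if "i < d" for i
    using e that by (simp add: S.orthonormal_def)
  have orth: "L2_inner M (e i) (e j) = (if i = j then 1 else 0)" if "i < d" "j < d" for i j
    using e that by (simp add: S.orthonormal_def)
  have separate: "L2_inner M x (e j) = 1" if "I2 M (e j) = I2 M x" "x \<in> X" "j < d" for x j
  proof -
    have "L2_inner M (e j - x) (e j) = 0"
      using that eX by (intro S.null_left) (auto simp: I2_eq_iff_sq)
    then show ?thesis
      using that eX orth by (simp add: S.diff_left)
  qed
  define Bs where "Bs = (\<lambda>i. I2 M (e i)) ` {..<d}"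
  have "inj_on (\<lambda>i. I2 M (e i)) {..<d}"
  proof (rule inj_onI)
    fix i j assume ij: "i \<in> {..<d}" "j \<in> {..<d}" "I2 M (e i) = I2 M (e j)"
    then have "L2_inner M (e j) (e i) = 1"
      using separate[of i "e j"] eX by simp
    then show "i = j"
      using ij orth[of j i] by (auto split: if_splits)
  qed
  then have card: "card Bs = d"
    by (simp add: Bs_def card_image)
  have "I2 M (e j) \<notin> span_in (X2 M X) (Bs - {I2 M (e j)})" if j: "j < d" for j
  proof
    \<comment> \<open>The hyperplane orthogonal to e_j contains all other basis functions, and by
      \<open>separate\<close> its image does not contain the class of e_j.\<close>
    define W where "W = {x \<in> X. L2_inner M x (e j) = 0}"
    have "CK.subspace W"
      unfolding W_def using eX[OF j] by (intro CK.subspaceI) (auto simp: S.add_left S.scale_left)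
    then have "subspace_in (X2 M X) (I2 M ` W)"
      by (rule subspace_in_X2[OF M]) (auto simp: W_def)
    moreover have "Bs - {I2 M (e j)} \<subseteq> I2 M ` W"
    proof
      fix b assume "b \<in> Bs - {I2 M (e j)}"
      then obtain i where "i < d" "b = I2 M (e i)" "i \<noteq> j"
        by (auto simp: Bs_def)
      then show "b \<in> I2 M ` W"
        using eX orth[of i j] j by (auto simp: W_def)
    qed
    moreover assume "I2 M (e j) \<in> span_in (X2 M X) (Bs - {I2 M (e j)})"
    ultimately have "I2 M (e j) \<in> I2 M ` W"
      by (auto simp: span_in_def)
    then show False
      using separate[OF _ _ j] by (auto simp: W_def)
  qed
  then have "\<forall>b\<in>Bs. b \<notin> span_in (X2 M X) (Bs - {b})"
    by (auto simp: Bs_def)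
  moreover have "span_in (X2 M X) Bs = I2 M ` CK.span (e ` {..<d})"
    using span_in_X2[OF M X, of "e ` {..<d}"] eX by (auto simp: Bs_def image_image)
  moreover have "Bs \<subseteq> vecs (X2 M X)"
    using eX by (auto simp: Bs_def vecs_X2)
  ultimately show ?thesis
    unfolding has_dim_def using card by (intro exI[of _ Bs]) (auto simp: Bs_def)
qed

lemma ex_orthogonal_projection:
  assumes e: "S.orthonormal d e" and d: "1 \<le> d" "d \<le> k"
  shows "\<exists>P. linear_op (X2 M X) (X2 M X) P \<and> (\<forall>f\<in>vecs (X2 M X). P (P f) = P f) \<and>
           opnorm (X2 M X) (X2 M X) P = 1 \<and> rank_le (X2 M X) (X2 M X) P k \<and>
           (\<forall>x\<in>X. P (I2 M x) = I2 M (S.proj d e x))"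
proof -
  note [simp] = S.proj_closed[OF e]
  have eX: "e i \<in> X" if "i < d" for i
    using e that by (simp add: S.orthonormal_def)
  \<comment> \<open>Any preimage will do: two preimages differ by a null vector and thus have the
    same coefficients.\<close>
  define P where "P A = I2 M (S.proj d e (SOME x. x \<in> X \<and> I2 M x = A))" for A
  have P: "P (I2 M x) = I2 M (S.proj d e x)" if "x \<in> X" for x
  proof -
    define y where "y = (SOME y. y \<in> X \<and> I2 M y = I2 M x)"
    have "y \<in> X \<and> I2 M y = I2 M x"
      unfolding y_def by (rule someI[of _ x]) (simp add: that)
    then have y: "y \<in> X" "S.sq (y - x) = 0"
      by (auto simp: I2_eq_iff_sq)
    have "L2_inner M y (e i) = L2_inner M x (e i)" if "i < d" for i
      using S.null_left[of "y - x" "e i"] y \<open>x \<in> X\<close> eX[OF that] by (simp add: S.diff_left)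
    then have "S.proj d e y = S.proj d e x"
      by (simp add: S.proj_def)
    then show ?thesis
      by (simp add: P_def y_def)
  qed
  have "linear_op (X2 M X) (X2 M X) P"
    by (auto simp: linear_op_def vecs_X2 vadd_I2[OF M] vscale_I2[OF M] P S.proj_add[OF e] S.proj_scale[OF e])
  moreover have "\<forall>f\<in>vecs (X2 M X). P (P f) = P f"
    by (auto simp: vecs_X2 P S.proj_idem[OF e])
  moreover have "opnorm (X2 M X) (X2 M X) P = 1"
  proof (rule antisym)
    show "opnorm (X2 M X) (X2 M X) P \<le> 1"
      unfolding opnorm_def
    proof (rule SUP_least)
      fix f assume "f \<in> {f \<in> vecs (X2 M X). vnorm (X2 M X) f \<le> 1}"
      then obtain x where x: "x \<in> X" "f = I2 M x" "sqrt (S.sq x) \<le> 1"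
        by (auto simp: vecs_X2 vnorm_I2_sq)
      have "sqrt (S.sq (S.proj d e x)) \<le> sqrt (S.sq x)"
        using S.pythagoras[OF e x(1)] by simp
      then show "ennreal (vnorm (X2 M X) (P f)) \<le> 1"
        using x by (simp add: P vnorm_I2_sq)
    qed
    \<comment> \<open>The norm 1 is attained at e_0, a unit vector fixed by P; it exists because d
      is at least 1.\<close>
    have "L2_inner M (e 0) (e i) = (if i = 0 then 1 else 0)" if "i < d" for i
      using e d that by (auto simp: S.orthonormal_def)
    then have "S.proj d e (e 0) = (\<Sum>i<d. if i = 0 then e 0 else 0)"
      unfolding S.proj_def by (intro sum.cong) auto
    then have "S.proj d e (e 0) = e 0"
      using d by simp
    moreover have "S.sq (e 0) = 1"
      using e d by (simp add: S.sq_def S.orthonormal_def)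
    ultimately show "1 \<le> opnorm (X2 M X) (X2 M X) P"
      unfolding opnorm_def using eX[of 0] d
      by (intro SUP_upper2[of "I2 M (e 0)"]) (auto simp: vecs_X2 vnorm_I2_sq P)
  qed
  moreover have "rank_le (X2 M X) (X2 M X) P k"
  proof -
    let ?E = "CK.span (e ` {..<d})"
    have "S.proj d e x \<in> ?E" for x
      by (rule S.proj_in) (auto intro: CK.span_base)
    moreover have "I2 M x \<in> P ` I2 M ` X" if "x \<in> ?E" for x
    proof -
      have x: "x \<in> X"
        using that CK.span_minimal[of "e ` {..<d}", OF _ X] eX by auto
      have "CK.subspace {x \<in> X. S.proj d e x = x}"
        by (rule CK.subspaceI) (auto simp: S.proj_add[OF e] S.proj_scale[OF e], simp add: S.proj_def eX)
      moreover have "S.proj d e (e j) = e j" if "j < d" for j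
      proof -
        have "L2_inner M (e j) (e i) = (if i = j then 1 else 0)" if "i < d" for i
          using e \<open>j < d\<close> that by (auto simp: S.orthonormal_def)
        then have "S.proj d e (e j) = (\<Sum>i<d. if i = j then e j else 0)"
          unfolding S.proj_def by (intro sum.cong) auto
        then show ?thesis
          using that by simp
      qed
      ultimately have "?E \<subseteq> {x \<in> X. S.proj d e x = x}"
        using eX by (intro CK.span_minimal) auto
      then have "P (I2 M x) = I2 M x"
        using that x by (auto simp: P)
      then show ?thesis
        using x by (metis imageI)
    qed
    ultimately have "P ` vecs (X2 M X) = I2 M ` ?E"
      by (auto simp: vecs_X2 P)
    then show ?thesis
      unfolding rank_le_def using has_dim_I2_span_orthonormal[OF e] d by auto
  qed
  ultimately show ?thesis
    using P by blast
qed

text \<open>Integrating the pointwise bound against a probability measure; in effect, the canonical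
  map into L_2 has \<pi>_2 at most 1.\<close>

lemma contractive_sum_sq_le:
  assumes "contractive I w"
  shows "(\<Sum>i\<in>I. S.sq (w i)) \<le> 1"
proof -
  interpret prob_space M
    using M by (simp add: prob_measures_def)
  have "(\<Sum>i\<in>I. S.sq (w i)) = (\<integral>t. (\<Sum>i\<in>I. (norm (apply_bcontfun (w i) t))\<^sup>2) \<partial>M)"
    unfolding S.sq_def norm_L2_inner_self[OF M]
    by (rule Bochner_Integration.integral_sum[symmetric]) (rule integrable_norm_sq[OF M])
  also have "\<dots> \<le> (\<integral>t. 1 \<partial>M)"
    using assms unfolding contractive_def
    by (intro integral_mono Bochner_Integration.integrable_sum integrable_norm_sq[OF M]) auto
  finally show ?thesis
    by (simp add: prob_space)
qed

end

section \<open>From an operator on X to a projection on X_2\<close>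

lemma semi_inner_ell2:
  assumes X: "CK.subspace X" and u: "linear_op (sub_CK X) (ell2 k) u"
  shows "semi_inner cj X (\<lambda>x y. \<Sum>i<k. u x i * cj (u y i))"
  using u by (intro semi_inner_sum_functionals X) (auto simp: linear_op_def sub_CK_def ell2_def)

lemma vnorm_ell2: "(vnorm (ell2 k) (u :: nat \<Rightarrow> 'f))\<^sup>2 = norm (\<Sum>i<k. u i * cj (u i))"
  by (simp add: ell2_def L2_set_def norm_sum_mult_cj sum_nonneg)

text \<open>Evaluation at a finite separating set T gives a definite form on X, which dominates that
  of u up to a constant C. Contractivity at each point of T then bounds the sums by C * card
  T.\<close>

lemma pi2_ell2_finite:
  fixes B :: "('a::topological_space \<Rightarrow>\<^sub>C 'f) set"
  assumes B: "finite B" and u: "linear_op (sub_CK (CK.span B)) (ell2 k) u"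
  shows "pi2 (sub_CK (CK.span B)) (ell2 k) u < \<infinity>"
proof -
  let ?X = "CK.span B"
  obtain T where T: "finite T" "\<And>x. x \<in> ?X \<Longrightarrow> (\<forall>t\<in>T. apply_bcontfun x t = 0) \<Longrightarrow> x = 0"
    using exists_finite_separating_set[OF B] by blast
  interpret T: semi_inner cj ?X "\<lambda>x y. \<Sum>t\<in>T. apply_bcontfun x t * cj (apply_bcontfun y t)"
    by (rule semi_inner_sum_functionals) auto
  interpret Q: semi_inner cj ?X "\<lambda>x y. \<Sum>i<k. u x i * cj (u y i)"
    by (rule semi_inner_ell2[OF _ u]) simp
  have Tsq: "T.sq x = (\<Sum>t\<in>T. (norm (apply_bcontfun x t))\<^sup>2)" for x
    unfolding T.sq_def by (rule norm_sum_mult_cj)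
  have "(\<Sum>i<k. u x i * cj (u x i)) = 0" if "x \<in> ?X" "T.sq x = 0" for x
  proof -
    have "\<forall>t\<in>T. apply_bcontfun x t = 0"
      using that(2) T(1) by (simp add: Tsq sum_nonneg_eq_0_iff)
    then show ?thesis
      using T(2)[OF that(1)] Q.zero_left[of 0] by simp
  qed
  then obtain C where C: "0 \<le> C" "\<And>x. x \<in> ?X \<Longrightarrow> Q.sq x \<le> C * T.sq x"
    using T.dominates[OF Q.semi_inner_axioms B] unfolding Q.sq_def by blast
  have "pi2 (sub_CK ?X) (ell2 k) u \<le> ennreal (sqrt (C * card T))"
    unfolding pi2_sub_CK[OF CK.subspace_span]
  proof (rule SUP_least, clarify)
    fix m and w :: "nat \<Rightarrow> 'a \<Rightarrow>\<^sub>C 'f"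
    assume w: "\<forall>i<m. w i \<in> ?X" "contractive {..<m} w"
    have "(\<Sum>i<m. (vnorm (ell2 k) (u (w i)))\<^sup>2) = (\<Sum>i<m. Q.sq (w i))"
      by (simp add: vnorm_ell2 Q.sq_def)
    also have "\<dots> \<le> (\<Sum>i<m. C * T.sq (w i))"
      using w C by (intro sum_mono) auto
    also have "\<dots> = C * (\<Sum>t\<in>T. \<Sum>i<m. (norm (apply_bcontfun (w i) t))\<^sup>2)"
      unfolding Tsq by (subst sum.swap) (simp add: sum_distrib_left)
    also have "\<dots> \<le> C * (\<Sum>t\<in>T. 1)"
      using w C by (intro mult_left_mono sum_mono) (auto simp: contractive_def)
    finally show "ennreal (sqrt (\<Sum>i<m. (vnorm (ell2 k) (u (w i)))\<^sup>2)) \<le> ennreal (sqrt (C * card T))"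
      by (intro ennreal_leI) simp
  qed
  also have "\<dots> < \<infinity>"
    by simp
  finally show ?thesis .
qed

text \<open>
  With \<open>M\<close> a Pietsch measure for \<open>u\<close>, the form \<open>r(x, y) = \<langle>x, y\<rangle>\<^sub>M - \<langle>u x, u y\<rangle> / \<pi>\<^sub>2(u)\<^sup>2\<close> is positive
  semidefinite; \<open>P\<close> is the orthogonal projection onto its null space \<open>E\<close>, on which \<open>u / \<pi>\<^sub>2(u)\<close> is
  isometric. Families that nearly attain \<open>\<pi>\<^sub>2(u)\<close> have small \<open>r\<close>, hence are close to \<open>E\<close>, which
  gives \<open>\<pi>\<^sub>2(P I) = 1\<close> without having to show that the supremum is attained.
\<close>

lemma ex_projection_of_operator:
  fixes B :: "('a::t2_space \<Rightarrow>\<^sub>C 'f) set"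
  assumes K: "compact (UNIV :: 'a set)" and B: "finite B" and X_def: "X = CK.span B"
    and u: "linear_op (sub_CK X) (ell2 k) u" and pi2_nz: "pi2 (sub_CK X) (ell2 k) u \<noteq> 0"
  shows "\<exists>M P. M \<in> prob_measures \<and> linear_op (X2 M X) (X2 M X) P \<and>
           (\<forall>f\<in>vecs (X2 M X). P (P f) = P f) \<and> opnorm (X2 M X) (X2 M X) P = 1 \<and>
           rank_le (X2 M X) (X2 M X) P k \<and> pi2 (sub_CK X) (X2 M X) (P \<circ> I2 M) = 1 \<and>
           pi2 (sub_CK X) (ell2 k) u / opnorm (sub_CK X) (ell2 k) u \<le> 1 / opnorm (sub_CK X) (X2 M X) (P \<circ> I2 M)"
proof -
  have X: "CK.subspace X"
    by (simp add: X_def)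
  define c where "c = enn2real (pi2 (sub_CK X) (ell2 k) u)"
  have pi2_c: "pi2 (sub_CK X) (ell2 k) u = ennreal c"
    using pi2_ell2_finite[OF B] u by (simp add: c_def X_def)
  then have c: "0 < c"
    using pi2_nz by (metis c_def enn2real_nonneg ennreal_0 order_le_less)
  let ?q = "\<lambda>x y. \<Sum>i<k. u x i * cj (u y i)"
  interpret Q: semi_inner cj X ?q
    by (rule semi_inner_ell2[OF X u])
  have vnorm_u: "(vnorm (ell2 k) (u x))\<^sup>2 = Q.sq x" for x
    by (simp add: vnorm_ell2 Q.sq_def)
  have vnorm_u_sqrt: "vnorm (ell2 k) (u x) = sqrt (Q.sq x)" for x
    by (simp add: Q.sq_def norm_sum_mult_cj ell2_def L2_set_def)
  have "(\<Sum>i\<in>I. Q.sq (w i)) \<le> c\<^sup>2"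
    if "finite I" "\<And>i. i \<in> I \<Longrightarrow> w i \<in> X" "contractive I w" for I :: "('a \<Rightarrow>\<^sub>C 'f) set" and w
  proof -
    have "ennreal (sqrt (\<Sum>i\<in>I. Q.sq (w i))) \<le> ennreal c"
      using pi2_lower[OF X that, of "ell2 k" u] by (simp add: vnorm_u pi2_c)
    then show ?thesis
      using c by (simp add: ennreal_le_iff real_le_lsqrt real_sqrt_le_iff sqrt_le_D)
  qed
  then have "\<exists>M\<in>prob_measures. \<forall>x\<in>X. Q.sq x \<le> c\<^sup>2 * (\<integral>t. (norm (apply_bcontfun x t))\<^sup>2 \<partial>M)"
    unfolding X_def by (intro pietsch_domination[OF K B]) (auto simp: Q.sq_scale[unfolded X_def])
  then obtain M where M: "M \<in> prob_measures"
    and pietsch: "\<And>x. x \<in> X \<Longrightarrow> Q.sq x \<le> c\<^sup>2 * (\<integral>t. (norm (apply_bcontfun x t))\<^sup>2 \<partial>M)"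
    by blast
  interpret S: semi_inner cj X "L2_inner M"
    by (rule semi_inner_L2_inner[OF M X])
  have QS: "Q.sq x / c\<^sup>2 \<le> S.sq x" if "x \<in> X" for x
    using pietsch[OF that] c by (simp add: S.sq_def norm_L2_inner_self[OF M] divide_le_eq mult.commute)
  define r where "r x y = L2_inner M x y - ?q x y / of_real (c\<^sup>2)" for x y
  have r_self: "r x x = of_real (S.sq x - Q.sq x / c\<^sup>2)" if "x \<in> X" for x
    using S.self[OF that] Q.self[OF that] by (simp add: r_def)
  interpret R: semi_inner cj X r
  proof unfold_locales
    fix x y a assume x: "x \<in> X" and y: "y \<in> X"
    show "r (x + y) z = r x z + r y z" if "z \<in> X" for z
      using x y that S.add_left[of x y z] Q.add_left[of x y z] by (simp add: r_def add_divide_distrib)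
    show "r (scaleF a x) y = a * r x y"
      using x y S.scale_left[of x y a] Q.scale_left[of x y a] by (simp add: r_def algebra_simps)
    have "cj (?q x y / of_real (c\<^sup>2)) = cj (?q x y * of_real (1 / c\<^sup>2))"
      by simp
    also have "\<dots> = cj (?q x y) * of_real (1 / c\<^sup>2)"
      by (simp only: cj_mult cj_of_real)
    finally show "r y x = cj (r x y)"
      using x y S.commute[of x y] Q.commute[of x y] by (simp add: r_def cj_diff)
    show "r x x = of_real (norm (r x x))"
      using QS[OF x] by (simp add: r_self[OF x] del: of_real_diff)
  qed (rule X)
  have Rsq: "R.sq x = S.sq x - Q.sq x / c\<^sup>2" if "x \<in> X" for x
    using that r_self[OF that] by (intro R.sq_eqI)
  define E where "E = {x \<in> X. R.sq x = 0}"
  have E: "CK.subspace E" "E \<subseteq> X"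
    using R.subspace_null by (auto simp: E_def)
  obtain B' where B': "B' \<subseteq> E" "CK.independent B'" "E \<subseteq> CK.span B'"
    using CK.maximal_independent_subset by blast
  have finB': "finite B'"
    using CK.independent_span_bound[OF B B'(2)] B'(1) E(2) by (auto simp: X_def)
  obtain d e where e: "S.orthonormal d e" "\<And>i. i < d \<Longrightarrow> e i \<in> CK.span B'"
      "\<And>x. x \<in> CK.span B' \<Longrightarrow> S.sq (x - S.proj d e x) = 0"
    using S.gram_schmidt[OF finB'] B'(1) E(2) by (meson subset_trans)
  note [simp] = S.proj_closed[OF e(1)]
  have eE: "e i \<in> E" if "i < d" for i
    using e(2)[OF that] CK.span_minimal[OF B'(1) E(1)] by auto
  have eX: "e i \<in> X" if "i < d" for i
    using eE[OF that] E(2) by auto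
  have projE: "S.proj d e x \<in> E" for x
    by (rule S.proj_in[OF E(1) eE])
  have residual_E: "S.sq (x - S.proj d e x) = 0" if "x \<in> E" for x
    using that B'(3) e(3) by auto
  \<comment> \<open>Subtracting the projection, a null vector of r, does not change
    \<open>R.sq x\<close>, and r is dominated by the L_2 form. Pythagoras turns this into P \<le>
    A*A.\<close>
  have proj_le: "S.sq (S.proj d e x) \<le> Q.sq x / c\<^sup>2" if "x \<in> X" for x
  proof -
    have "R.sq x = R.sq (x - S.proj d e x)"
      using R.sq_null_add[of "x - S.proj d e x" "S.proj d e x"] projE[of x] that by (simp add: E_def)
    also have "\<dots> \<le> S.sq (x - S.proj d e x)"
      using that by (simp add: Rsq)
    finally show ?thesis
      using S.pythagoras[OF e(1) that] Rsq[OF that] by simp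
  qed
  \<comment> \<open>The form of squared L_2 distance to E. It vanishes on the null vectors of r, so
    it is at most a multiple C of r; this makes precise that small r forces closeness to E.\<close>
  let ?h = "\<lambda>x y. L2_inner M (x - S.proj d e x) (y - S.proj d e y)"
  have "semi_inner cj X ?h"
  proof unfold_locales
    fix x y a assume x: "x \<in> X" and y: "y \<in> X"
    show "?h (x + y) z = ?h x z + ?h y z" if "z \<in> X" for z
      using x y that S.add_left[of "x - S.proj d e x" "y - S.proj d e y" "z - S.proj d e z"]
      by (simp add: S.proj_add[OF e(1)] add_diff_add)
    show "?h (scaleF a x) y = a * ?h x y"
      using x y S.scale_left[of "x - S.proj d e x" "y - S.proj d e y" a]
      by (simp add: S.proj_scale[OF e(1)] CK.scale_right_diff_distrib)
    show "?h y x = cj (?h x y)"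
      using x y by (intro S.commute) auto
    show "?h x x = of_real (norm (?h x x))"
      using x by (intro S.self_norm) auto
  qed (rule X)
  moreover have "?h x x = 0" if "x \<in> X" "R.sq x = 0" for x
    using residual_E[of x] that by (simp add: E_def S.sq_def)
  ultimately obtain C where C: "0 \<le> C" "\<And>x. x \<in> X \<Longrightarrow> S.sq (x - S.proj d e x) \<le> C * R.sq x"
    using R.dominates[OF _ B X_def, of ?h] unfolding S.sq_def by blast
  have u_scale: "u (scaleF a x) j = a * u x j" if "x \<in> X" for a x j
    using u that by (auto simp: linear_op_def sub_CK_def ell2_def)
  \<comment> \<open>Count the squared entries of the matrix of u / c on the system e: each of the d
    vectors contributes exactly 1, since u / c is isometric on E, and each of the k coordinates
    contributes at most 1.\<close>
  have dk: "d \<le> k"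
  proof -
    have column: "(\<Sum>i<d. (norm (u (e i) j))\<^sup>2) \<le> c\<^sup>2" if j: "j < k" for j
    proof -
      define A where "A = (\<Sum>i<d. (norm (u (e i) j))\<^sup>2)"
      \<comment> \<open>The combination of the e_i that maximises the j-th coordinate: (u z)_j = A,
        while the isometry on E gives \<open>Q.sq z\<close> = c^2 * A, so A^2 \<le> c^2 * A.\<close>
      define z where "z = (\<Sum>i<d. scaleF (cj (u (e i) j)) (e i))"
      have zE: "z \<in> E"
        unfolding z_def using eE by (intro CK.subspace_sum CK.subspace_scale E(1)) auto
      have "S.sq z = A"
        unfolding z_def A_def by (subst S.sq_orthonormal_sum[OF e(1)]) simp
      then have Qz: "Q.sq z = c\<^sup>2 * A"
        using Rsq[of z] zE c by (simp add: E_def field_simps)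
      have "u (\<Sum>i\<in>I. scaleF (a i) (e i)) j = (\<Sum>i\<in>I. a i * u (e i) j)" if "I \<subseteq> {..<d}" "finite I" for I a
        using that(2,1)
      proof (induction I rule: finite_induct)
        case empty
        show ?case
          using u_scale[of 0 0 j] by simp
      next
        case (insert i I)
        then have mem: "scaleF (a i) (e i) \<in> X" "(\<Sum>i\<in>I. scaleF (a i) (e i)) \<in> X" "e i \<in> X"
          using eX by auto
        then have "u (scaleF (a i) (e i) + (\<Sum>i\<in>I. scaleF (a i) (e i))) j =
            u (scaleF (a i) (e i)) j + u (\<Sum>i\<in>I. scaleF (a i) (e i)) j"
          using u by (auto simp: linear_op_def sub_CK_def ell2_def)
        then show ?case
          using insert by (simp add: u_scale mem)
      qed
      from this[of "{..<d}" "\<lambda>i. cj (u (e i) j)"]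
      have "u z j = (\<Sum>i<d. u (e i) j * cj (u (e i) j))"
        by (simp add: z_def mult.commute)
      then have "norm (u z j) = A"
        by (simp add: A_def norm_sum_mult_cj)
      then have "A\<^sup>2 \<le> Q.sq z"
        using j member_le_sum[of j "{..<k}" "\<lambda>j. (norm (u z j))\<^sup>2"] by (simp add: Q.sq_def norm_sum_mult_cj)
      then have "A * A \<le> c\<^sup>2 * A"
        by (simp add: Qz power2_eq_square)
      moreover have "0 \<le> A"
        by (simp add: A_def sum_nonneg)
      ultimately have "A \<le> c\<^sup>2"
        by (cases "A = 0") auto
      then show ?thesis
        by (simp add: A_def)
    qed
    have "Q.sq (e i) = c\<^sup>2" if "i < d" for i
      using Rsq[OF eX[OF that]] eE[OF that] e(1) that c
      by (simp add: E_def S.orthonormal_def S.sq_def)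
    then have "real d * c\<^sup>2 = (\<Sum>i<d. \<Sum>j<k. (norm (u (e i) j))\<^sup>2)"
      by (simp add: Q.sq_def norm_sum_mult_cj)
    also have "\<dots> = (\<Sum>j<k. \<Sum>i<d. (norm (u (e i) j))\<^sup>2)"
      by (rule sum.swap)
    also have "\<dots> \<le> (\<Sum>j<k. c\<^sup>2)"
      using column by (intro sum_mono) auto
    finally show ?thesis
      using c by simp
  qed
  have pi2_proj: "(SUP (m, w)\<in>{(m :: nat, w). 1 \<le> m \<and> (\<forall>i<m. w i \<in> X) \<and> contractive {..<m} w}.
      ennreal (sqrt (\<Sum>i<m. S.sq (S.proj d e (w i))))) = 1" (is "?p = 1")
  proof (rule antisym)
    show le1: "?p \<le> 1"
    proof (rule SUP_least, clarify)
      fix m :: nat and w :: "nat \<Rightarrow> 'a \<Rightarrow>\<^sub>C 'f"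
      assume w: "\<forall>i<m. w i \<in> X" "contractive {..<m} w"
      have "(\<Sum>i<m. S.sq (S.proj d e (w i))) \<le> (\<Sum>i<m. S.sq (w i))"
        using S.bessel[OF e(1)] w(1) by (intro sum_mono) (auto simp: S.sq_proj[OF e(1)])
      also have "\<dots> \<le> 1"
        by (rule contractive_sum_sq_le[OF M X w(2)])
      finally show "ennreal (sqrt (\<Sum>i<m. S.sq (S.proj d e (w i)))) \<le> 1"
        by simp
    qed
    define p where "p = enn2real ?p"
    have p: "?p = ennreal p" "0 \<le> p"
      unfolding p_def
      using ennreal_enn2real[OF le_less_trans[OF le1 ennreal_one_less_top]] by (simp_all only: enn2real_nonneg)
    \<comment> \<open>The constant solves \<theta> \<le> p^2 + C * (1 - \<theta>), where \<theta> is
      the normalised sum of a family. The term p^2 bounds the projected part, and C * (1 - \<theta>)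
      the residuals, as the sum of r is at most 1 - \<theta>. Since the supremum of c * sqrt
      \<theta> is c itself, p < 1 is impossible.\<close>
    have "pi2 (sub_CK X) (ell2 k) u \<le> ennreal (c * sqrt ((p\<^sup>2 + C) / (1 + C)))"
      unfolding pi2_sub_CK[OF X]
    proof (rule SUP_least, clarify)
      fix m :: nat and w :: "nat \<Rightarrow> 'a \<Rightarrow>\<^sub>C 'f"
      assume m: "1 \<le> m" and w: "\<forall>i<m. w i \<in> X" "contractive {..<m} w"
      define \<theta> where "\<theta> = (\<Sum>i<m. Q.sq (w i)) / c\<^sup>2"
      have "ennreal (sqrt (\<Sum>i<m. S.sq (S.proj d e (w i)))) \<le> ?p"
        using m w by (intro SUP_upper2[of "(m, w)"]) auto
      then have "sqrt (\<Sum>i<m. S.sq (S.proj d e (w i))) \<le> p"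
        using p by simp
      then have "(\<Sum>i<m. S.sq (S.proj d e (w i))) \<le> p\<^sup>2"
        by (rule sqrt_le_D)
      moreover have "(\<Sum>i<m. S.sq (w i)) = (\<Sum>i<m. S.sq (S.proj d e (w i))) + (\<Sum>i<m. S.sq (w i - S.proj d e (w i)))"
        unfolding sum.distrib[symmetric] using w(1) by (intro sum.cong refl S.pythagoras[OF e(1)]) auto
      moreover have "(\<Sum>i<m. S.sq (w i - S.proj d e (w i))) \<le> C * (\<Sum>i<m. R.sq (w i))"
        unfolding sum_distrib_left using C w(1) by (intro sum_mono) auto
      moreover have R_sum: "(\<Sum>i<m. R.sq (w i)) = (\<Sum>i<m. S.sq (w i)) - \<theta>"
        using w(1) by (simp add: Rsq \<theta>_def sum_subtractf sum_divide_distrib)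
      moreover have "(\<Sum>i<m. S.sq (w i)) \<le> 1"
        by (rule contractive_sum_sq_le[OF M X w(2)])
      moreover have "0 \<le> (\<Sum>i<m. R.sq (w i))"
        by (simp add: sum_nonneg)
      ultimately have "\<theta> \<le> p\<^sup>2 + C * (1 - \<theta>)"
        using C(1) mult_left_mono[of "(\<Sum>i<m. S.sq (w i)) - \<theta>" "1 - \<theta>" C] by simp
      then have "\<theta> \<le> (p\<^sup>2 + C) / (1 + C)"
        using C(1) by (simp add: field_simps)
      then have "sqrt (c\<^sup>2 * \<theta>) \<le> sqrt (c\<^sup>2 * ((p\<^sup>2 + C) / (1 + C)))"
        by (intro real_sqrt_le_mono mult_left_mono) auto
      moreover have "c\<^sup>2 * \<theta> = (\<Sum>i<m. (vnorm (ell2 k) (u (w i)))\<^sup>2)"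
        using c by (simp add: \<theta>_def vnorm_u)
      moreover have "sqrt (c\<^sup>2 * ((p\<^sup>2 + C) / (1 + C))) = c * sqrt ((p\<^sup>2 + C) / (1 + C))"
        using c by (simp only: real_sqrt_mult real_sqrt_abs)
      ultimately show "ennreal (sqrt (\<Sum>i<m. (vnorm (ell2 k) (u (w i)))\<^sup>2)) \<le> ennreal (c * sqrt ((p\<^sup>2 + C) / (1 + C)))"
        by (intro ennreal_leI) (simp only:)
    qed
    then have "c \<le> c * sqrt ((p\<^sup>2 + C) / (1 + C))"
      unfolding pi2_c using c C(1) by (subst (asm) ennreal_le_iff) auto
    then have "1 \<le> (p\<^sup>2 + C) / (1 + C)"
      using c by simp
    then have "1 \<le> p\<^sup>2"
      using C(1) by (simp add: field_simps)
    then have "1 \<le> p"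
      using p(2) power2_le_imp_le[of 1 p] by simp
    then show "1 \<le> ?p"
      using p by simp
  qed
  have "1 \<le> d"
  proof (rule ccontr)
    assume "\<not> 1 \<le> d"
    then have "d = 0" by simp
    then have "S.sq (S.proj d e x) = 0" for x
      using S.sq_proj[OF e(1), of x] by simp
    then have "?p \<le> 0"
      by (intro SUP_least) auto
    then show False
      using pi2_proj by simp
  qed
  then obtain P where P: "linear_op (X2 M X) (X2 M X) P" "\<forall>f\<in>vecs (X2 M X). P (P f) = P f"
    "opnorm (X2 M X) (X2 M X) P = 1" "rank_le (X2 M X) (X2 M X) P k"
    "\<And>x. x \<in> X \<Longrightarrow> P (I2 M x) = I2 M (S.proj d e x)"
    using ex_orthogonal_projection[OF M X e(1) _ dk] by blast
  have PI: "vnorm (X2 M X) ((P \<circ> I2 M) x) = sqrt (S.sq (S.proj d e x))" if "x \<in> X" for x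
    using P(5)[OF that] by (simp add: vnorm_I2_sq[OF M X])
  have pi2_PI: "pi2 (sub_CK X) (X2 M X) (P \<circ> I2 M) = 1"
    unfolding pi2_sub_CK[OF X]
    by (rule trans[OF SUP_cong pi2_proj]) (auto simp: PI simp del: o_apply)
  let ?a = "opnorm (sub_CK X) (ell2 k) u" and ?b = "opnorm (sub_CK X) (X2 M X) (P \<circ> I2 M)"
  \<comment> \<open>The form inequality \<open>proj_le\<close> in terms of norms; after inversion
    the factor c in the numerator is \<pi>_2(u).\<close>
  have "?b \<le> ennreal (1 / c) * ?a"
  proof (rule opnorm_le_mult)
    fix x assume "x \<in> vecs (sub_CK X)"
    then have x: "x \<in> X"
      by (simp add: sub_CK_def)
    have "sqrt (S.sq (S.proj d e x)) \<le> sqrt (Q.sq x / c\<^sup>2)"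
      using proj_le[OF x] by (rule real_sqrt_le_mono)
    then show "vnorm (X2 M X) ((P \<circ> I2 M) x) \<le> 1 / c * vnorm (ell2 k) (u x)"
      using c unfolding PI[OF x] vnorm_u_sqrt by (simp add: real_sqrt_divide)
  qed (use c in simp)
  then have "1 / (ennreal (1 / c) * ?a) \<le> 1 / ?b"
    unfolding divide_ennreal_def by (intro mult_left_mono ennreal_inverse_antimono) auto
  moreover have "inverse (ennreal (1 / c) * ?a) = ennreal c * inverse ?a"
    using c by (subst ennreal_inverse_mult') (auto simp: inverse_ennreal)
  ultimately have "pi2 (sub_CK X) (ell2 k) u / ?a \<le> 1 / ?b"
    unfolding pi2_c divide_ennreal_def by simp
  then show ?thesis
    using M P(1-4) pi2_PI by blast
qed

lemma sup_pi2_ratio_eq_sup_projection: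
  fixes X :: "('a::t2_space \<Rightarrow>\<^sub>C 'f) set"
  assumes K: "compact (UNIV :: 'a set)" and X: "CK.subspace X" and dim: "CK.dim X \<noteq> 0"
  shows "(SUP u\<in>{u. linear_op (sub_CK X) (ell2 k) u}.
           pi2 (sub_CK X) (ell2 k) u / opnorm (sub_CK X) (ell2 k) u) =
        (SUP (M, P)\<in>{(M, P). M \<in> prob_measures \<and> linear_op (X2 M X) (X2 M X) P \<and>
             (\<forall>f\<in>vecs (X2 M X). P (P f) = P f) \<and> opnorm (X2 M X) (X2 M X) P = 1 \<and>
             rank_le (X2 M X) (X2 M X) P k \<and> pi2 (sub_CK X) (X2 M X) (P \<circ> I2 M) = 1}.
           1 / opnorm (sub_CK X) (X2 M X) (P \<circ> I2 M))" (is "?L = ?R")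
proof (rule antisym)
  obtain B where B: "CK.independent B" "CK.span B = X" "card B = CK.dim X"
    using CK.maximal_independent_subset[of X] CK.basis_card_eq_dim CK.span_subspace[OF _ _ X] by metis
  \<comment> \<open>\<open>CK.dim\<close> is also 0 when a basis is infinite, so a nonzero dimension
    already implies finite dimension.\<close>
  then have "finite B"
    using dim card.infinite by fastforce
  show "?L \<le> ?R"
  proof (rule SUP_least, clarify)
    fix u assume u: "linear_op (sub_CK X) (ell2 k) u"
    show "pi2 (sub_CK X) (ell2 k) u / opnorm (sub_CK X) (ell2 k) u \<le> ?R"
    \<comment> \<open>If \<pi>_2(u) = 0, the quotient is 0 by the convention of
      \<open>ennreal\<close>, and there is no normalisation to carry out.\<close>
    proof (cases "pi2 (sub_CK X) (ell2 k) u = 0")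
      case False
      then show ?thesis
        using ex_projection_of_operator[OF K \<open>finite B\<close> B(2)[symmetric] u] by (force intro: SUP_upper2)
    qed simp
  qed
  show "?R \<le> ?L"
  proof (rule SUP_least, clarify)
    fix M :: "'a measure" and P
    assume "M \<in> prob_measures" "linear_op (X2 M X) (X2 M X) P" "rank_le (X2 M X) (X2 M X) P k"
      and one: "pi2 (sub_CK X) (X2 M X) (P \<circ> I2 M) = 1"
    then obtain u where u: "linear_op (sub_CK X) (ell2 k) u"
      "\<And>x. x \<in> X \<Longrightarrow> vnorm (ell2 k) (u x) = vnorm (X2 M X) (P (I2 M x))"
      using ex_operator_with_same_norms[OF _ X] by blast
    have "1 / opnorm (sub_CK X) (X2 M X) (P \<circ> I2 M) = pi2 (sub_CK X) (ell2 k) u / opnorm (sub_CK X) (ell2 k) u"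
      using pi2_opnorm_cong[OF X, of "ell2 k" u "X2 M X" "P \<circ> I2 M"] u(2) one by simp
    then show "1 / opnorm (sub_CK X) (X2 M X) (P \<circ> I2 M) \<le> ?L"
      using u(1) by (intro SUP_upper2[of u]) auto
  qed
qed

end

theorem proposition2p6:
  fixes n k :: nat
  assumes "compact (UNIV :: 'a::t2_space set)"
    and "1 \<le> k" and "k \<le> n"
  shows
    "(\<forall>X :: ('a \<Rightarrow>\<^sub>C real) set. CK.subspace X \<and> CK.dim X = n \<longrightarrow>
        (SUP u\<in>{u. linear_op (sub_CK X) (ell2 k) u}.
           pi2 (sub_CK X) (ell2 k) u / opnorm (sub_CK X) (ell2 k) u) =
        (SUP (M, P)\<in>{(M, P). M \<in> prob_measures \<and> linear_op (X2 M X) (X2 M X) P \<and>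
             (\<forall>f\<in>vecs (X2 M X). P (P f) = P f) \<and> opnorm (X2 M X) (X2 M X) P = 1 \<and>
             rank_le (X2 M X) (X2 M X) P k \<and> pi2 (sub_CK X) (X2 M X) (P \<circ> I2 M) = 1}.
           1 / opnorm (sub_CK X) (X2 M X) (P \<circ> I2 M))) \<and>
     (\<forall>X :: ('a \<Rightarrow>\<^sub>C complex) set. CK.subspace X \<and> CK.dim X = n \<longrightarrow>
        (SUP u\<in>{u. linear_op (sub_CK X) (ell2 k) u}.
           pi2 (sub_CK X) (ell2 k) u / opnorm (sub_CK X) (ell2 k) u) =
        (SUP (M, P)\<in>{(M, P). M \<in> prob_measures \<and> linear_op (X2 M X) (X2 M X) P \<and>
             (\<forall>f\<in>vecs (X2 M X). P (P f) = P f) \<and> opnorm (X2 M X) (X2 M X) P = 1 \<and>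
             rank_le (X2 M X) (X2 M X) P k \<and> pi2 (sub_CK X) (X2 M X) (P \<circ> I2 M) = 1}.
           1 / opnorm (sub_CK X) (X2 M X) (P \<circ> I2 M)))"
proof -
  interpret real_conjugation: conjugation "\<lambda>x :: real. x"
    by unfold_locales (auto simp: power2_eq_square)
  interpret complex_conjugation: conjugation cnj
    by unfold_locales (auto simp: complex_norm_square[symmetric] simp del: of_real_power)
  have "n \<noteq> 0"
    using assms(2,3) by simp
  then show ?thesis
    using real_conjugation.sup_pi2_ratio_eq_sup_projection[OF assms(1)]
      complex_conjugation.sup_pi2_ratio_eq_sup_projection[OF assms(1)]
    by auto
qed

end
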